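(* For every positive integer $t$ there exists $n_0$ such that for all $n\ge n_0$, \[\mathrm{ex}_3(n,\mathrm{Tr}(B_t))=\left\lfloor \frac{(n-1)^2}{4}\right\rfloor,\] and the only $n$-vertex $3$-uniform $\mathrm{Tr}(B_t)$-free hypergraph attaining this value (up to isomorphism) is the one obtained by taking a complete bipartite graph with parts of sizes $\lfloor (n-1)/2\rfloor$ and $\lceil (n-1)/2\rceil$ on $n-1$ vertices, adding one new vertex $z$, and letting the hyperedges be the sets $e\cup\{z\}$ for all edges $e$ of the complete bipartite graph.
   Context: The book graph $B_t$ is the graph consisting of $t$ triangles sharing a common edge, i.e. the complete tripartite graph $K_{1,1,t}$. For a graph $F$ and an integer $r\ge 2$, $\mathrm{Tr}(F)$ denotes the family of $r$-uniform hypergraphs $\mathcal{F}$ for which $V(F)\subseteq V(\mathcal{F})$ and there is a bijection $f$ from the edges of $F$ to the hyperedges of $\mathcal{F}$ with $f(e)\cap V(F)=e$ for every edge $e$ of $F$ (i.e. each edge of $F$ is enlarged to a hyperedge using only vertices outside $V(F)$; equivalently, the trace of $\mathcal{F}$ on $V(F)$ is $F$). An $r$-uniform hypergraph is $\mathrm{Tr}(F)$-free if it contains no subhypergraph isomorphic to a member of $\mathrm{Tr}(F)$. $\mathrm{ex}_r(n,\mathrm{Tr}(F))$ is the maximum number of hyperedges in an $n$-vertex $r$-uniform $\mathrm{Tr}(F)$-free hypergraph. Here $r=3$. *)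

theory Defs
  imports Main
begin

definition uniform3_on :: "nat \<Rightarrow> nat set set \<Rightarrow> bool" where
  "uniform3_on n H \<longleftrightarrow> (\<forall>h\<in>H. h \<subseteq> {..<n} \<and> card h = 3)"

definition contains_trace :: "'a set set \<Rightarrow> 'b set \<Rightarrow> 'b set set \<Rightarrow> bool" where
  "contains_trace H V E \<longleftrightarrow>
     (\<exists>(\<phi>::'b \<Rightarrow> 'a) (f::'b set \<Rightarrow> 'a set). inj_on \<phi> V \<and> inj_on f E \<and>
        (\<forall>e\<in>E. f e \<in> H \<and> f e \<inter> \<phi> ` V = \<phi> ` e))"

text \<open>The book graph B_t = K_{1,1,t}: spine vertices 0 and 1, page vertices 2..t+1.\<close>
definition book_V :: "nat \<Rightarrow> nat set" where
  "book_V t = {0..t+1}"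

definition book_E :: "nat \<Rightarrow> nat set set" where
  "book_E t = {{0,1}} \<union> {{0,i} | i. i \<in> {2..t+1}} \<union> {{1,i} | i. i \<in> {2..t+1}}"

definition ex3_trace :: "nat \<Rightarrow> 'b set \<Rightarrow> 'b set set \<Rightarrow> nat" where
  "ex3_trace n V E = Max (card ` {H. uniform3_on n H \<and> \<not> contains_trace H V E})"

text \<open>The extremal construction: vertex z = n-1, complete bipartite graph between
  A = {0..<(n-1) div 2} and B = {(n-1) div 2..<n-1}, hyperedges e \<union> {z}.\<close>
definition star_bip :: "nat \<Rightarrow> nat set set" where
  "star_bip n = {{a, b, n - 1} | a b. a < (n - 1) div 2 \<and> (n - 1) div 2 \<le> b \<and> b < n - 1}"

end

theory Submission
  imports Defs Complex_Main
begin

text \<open>If \<open>H\<close> is free of the trace, then a spine \<open>u v\<close> has boundedly many vertices \<open>p\<close> such that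
  \<open>u p\<close> and \<open>v p\<close> extend to hyperedges avoiding \<open>v\<close> and \<open>u\<close>: otherwise one chooses pages
  greedily that avoid the extending vertices.

  Pick from each hyperedge having a pair that lies in no other hyperedge one such pair; these pairs
  form a graph \<open>G\<close> in which adjacent vertices have boundedly many common neighbours. In each of the
  remaining hyperedges (the set \<open>B\<close>) every pair lies in a second hyperedge, so \<open>B\<close> consists of
  triangles of a graph whose edges lie in boundedly many triangles, and \<open>B\<close> has \<open>o(n\<^sup>2)\<close> elements
  by the Ruzsa--Szemeredi theorem (an energy increment argument). Hence \<open>G\<close> has almost
  \<open>n\<^sup>2/4\<close> edges and, by a variance computation on its degrees, is almost complete bipartite between
  \<open>X\<close> and \<open>Y\<close> up to a small set \<open>R\<close> of vertices of low degree, and every hyperedge meets \<open>R\<close>.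
  Each vertex of \<open>R\<close> costs a linear number of edges of \<open>G\<close>. Vertices of \<open>R\<close> with many
  neighbours both in \<open>X\<close> and in \<open>Y\<close> (hubs) have almost no edges in \<open>G\<close> and cost about \<open>n/2\<close>,
  and their hyperedges in \<open>B\<close> are compensated by missing pairs between \<open>X\<close> and \<open>Y\<close>; the other
  vertices of \<open>R\<close> lie in few hyperedges of \<open>B\<close>. The budget \<open>n/2\<close> forces \<open>R\<close> to be a single
  hub.\<close>

section \<open>Averages over cells and their energy\<close>

text \<open>The conditional expectation of \<open>f\<close> given \<open>k\<close>, for the uniform
  measure on \<open>\<Omega>\<close>. A partition is encoded by a key function whose fibres are its
  cells, so a refinement is a key that determines the old one.\<close>

definition cell_avg :: "'b set \<Rightarrow> ('b \<Rightarrow> 'k) \<Rightarrow> ('b \<Rightarrow> real) \<Rightarrow> 'b \<Rightarrow> real" where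
  "cell_avg \<Omega> k f w = (\<Sum>x | x \<in> \<Omega> \<and> k x = k w. f x) / real (card {x \<in> \<Omega>. k x = k w})"

text \<open>Conditional expectation is self-adjoint: \<open>g\<close> factors out of each cell, and
  the average times the size of a cell is the sum over it.\<close>

lemma sum_mult_cell_avg:
  assumes fin: "finite \<Omega>"
    and g: "\<And>x y. x \<in> \<Omega> \<Longrightarrow> y \<in> \<Omega> \<Longrightarrow> k x = k y \<Longrightarrow> g x = g y"
  shows "(\<Sum>w\<in>\<Omega>. g w * cell_avg \<Omega> k f w) = (\<Sum>w\<in>\<Omega>. g w * f w)"
proof -
  have grp: "(\<Sum>w\<in>\<Omega>. F w) = (\<Sum>a\<in>k ` \<Omega>. \<Sum>w | w \<in> \<Omega> \<and> k w = a. F w)" for F :: "'a \<Rightarrow> real"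
    using sum.group[of \<Omega> "k ` \<Omega>" k F] fin by simp
  have "(\<Sum>w | w \<in> \<Omega> \<and> k w = a. g w * cell_avg \<Omega> k f w) = (\<Sum>w | w \<in> \<Omega> \<and> k w = a. g w * f w)"
    if a: "a \<in> k ` \<Omega>" for a
  proof -
    obtain w0 where w0: "w0 \<in> \<Omega>" "k w0 = a" using a by auto
    let ?c = "{w \<in> \<Omega>. k w = a}"
    have c: "card ?c \<noteq> 0" using w0 fin by auto
    have "(\<Sum>w\<in>?c. g w * cell_avg \<Omega> k f w) = (\<Sum>w\<in>?c. g w0 * ((\<Sum>x\<in>?c. f x) / card ?c))"
    proof (intro sum.cong refl)
      fix w assume "w \<in> ?c"
      then have "w \<in> \<Omega>" "k w = a" by auto
      then show "g w * cell_avg \<Omega> k f w = g w0 * ((\<Sum>x\<in>?c. f x) / card ?c)"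
        using g[of w w0] w0 by (simp add: cell_avg_def)
    qed
    also have "\<dots> = g w0 * (\<Sum>x\<in>?c. f x)" using c by simp
    also have "\<dots> = (\<Sum>x\<in>?c. g x * f x)"
      unfolding sum_distrib_left
    proof (intro sum.cong refl)
      fix w assume "w \<in> ?c"
      then show "g w0 * f w = g w * f w" using g[of w w0] w0 by auto
    qed
    finally show ?thesis by simp
  qed
  then show ?thesis unfolding grp by (rule sum.cong[OF refl])
qed

text \<open>\<open>W\<close> is a union of cells, so its indicator is an admissible \<open>g\<close>
  in \<open>sum_mult_cell_avg\<close>.\<close>

lemma sum_cell_avg_closed:
  assumes fin: "finite \<Omega>" and W: "W \<subseteq> \<Omega>"
    and cl: "\<And>x y. x \<in> W \<Longrightarrow> y \<in> \<Omega> \<Longrightarrow> k x = k y \<Longrightarrow> y \<in> W"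
  shows "(\<Sum>w\<in>W. cell_avg \<Omega> k f w) = (\<Sum>w\<in>W. f w)"
proof -
  have "(\<Sum>w\<in>\<Omega>. of_bool (w \<in> W) * cell_avg \<Omega> k f w) = (\<Sum>w\<in>\<Omega>. of_bool (w \<in> W) * f w)"
  proof (rule sum_mult_cell_avg[OF fin])
    fix x y assume "x \<in> \<Omega>" "y \<in> \<Omega>" "k x = k y"
    then have "x \<in> W \<longleftrightarrow> y \<in> W" using cl[of x y] cl[of y x] by auto
    then show "of_bool (x \<in> W) = (of_bool (y \<in> W) :: real)" by simp
  qed
  moreover have "(\<Sum>w\<in>\<Omega>. of_bool (w \<in> W) * F w) = (\<Sum>w\<in>W. F w)" for F :: "'a \<Rightarrow> real"
    using fin W by (simp add: of_bool_def if_distrib[of "\<lambda>x. x * _"] sum.If_cases Int_absorb1 cong: if_cong)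
  ultimately show ?thesis by simp
qed

text \<open>Cleaning up sparse cells: the indicator of a low average is constant on cells, so the
  counted points can be replaced by averages, each below \<open>\<eta>\<close>.\<close>

lemma card_low_cell_avg_le:
  assumes fin: "finite \<Omega>" and e: "0 \<le> \<eta>"
  shows "real (card {w \<in> \<Omega>. P w \<and> cell_avg \<Omega> k (\<lambda>x. of_bool (P x)) w < \<eta>}) \<le> \<eta> * card \<Omega>"
proof -
  let ?m = "cell_avg \<Omega> k (\<lambda>x. of_bool (P x))"
  have "real (card {w \<in> \<Omega>. P w \<and> ?m w < \<eta>}) = (\<Sum>w\<in>\<Omega>. of_bool (?m w < \<eta>) * of_bool (P w))"
    using fin by (auto simp: of_bool_def if_distrib[of "\<lambda>x. x * _"] sum.If_cases Int_def cong: if_cong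
        intro!: arg_cong[where f = card])
  also have "\<dots> = (\<Sum>w\<in>\<Omega>. of_bool (?m w < \<eta>) * ?m w)"
    by (rule sum_mult_cell_avg[symmetric, OF fin]) (simp add: cell_avg_def)
  also have "\<dots> \<le> (\<Sum>w\<in>\<Omega>. \<eta>)"
    by (rule sum_mono) (use e in auto)
  finally show ?thesis by (simp add: mult.commute)
qed

text \<open>The index of a partition in the sense of Szemeredi, not divided by the size of
  \<open>\<Omega>\<close>.\<close>

definition energy :: "'b set \<Rightarrow> ('b \<Rightarrow> 'k) \<Rightarrow> ('b \<Rightarrow> real) \<Rightarrow> real" where
  "energy \<Omega> k f = (\<Sum>w\<in>\<Omega>. (cell_avg \<Omega> k f w)\<^sup>2)"

lemma energy_nonneg: "0 \<le> energy \<Omega> k f"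
  unfolding energy_def by (rule sum_nonneg) simp

lemma energy_le_card:
  assumes "finite \<Omega>" and "\<And>w. w \<in> \<Omega> \<Longrightarrow> 0 \<le> f w \<and> f w \<le> 1"
  shows "energy \<Omega> k f \<le> card \<Omega>"
proof -
  have "(cell_avg \<Omega> k f w)\<^sup>2 \<le> 1" if "w \<in> \<Omega>" for w
  proof -
    let ?c = "{x \<in> \<Omega>. k x = k w}"
    have c: "card ?c > 0" using that assms by (auto simp: card_gt_0_iff)
    have "0 \<le> sum f ?c" by (rule sum_nonneg) (use assms in auto)
    moreover have "sum f ?c \<le> card ?c"
      using sum_mono[of ?c f "\<lambda>_. 1"] assms by auto
    ultimately have "0 \<le> cell_avg \<Omega> k f w" "cell_avg \<Omega> k f w \<le> 1"
      using c by (auto simp: cell_avg_def field_simps)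
    then show ?thesis by (simp add: power_le_one)
  qed
  then show ?thesis using sum_mono[of \<Omega> "\<lambda>w. (cell_avg \<Omega> k f w)\<^sup>2" "\<lambda>_. 1"]
    by (simp add: energy_def)
qed

text \<open>Pythagoras: the coarse average is constant on the fine cells, so its inner product with
  the fine average equals its own square norm.\<close>

lemma energy_refine:
  assumes fin: "finite \<Omega>"
    and ref: "\<And>x y. x \<in> \<Omega> \<Longrightarrow> y \<in> \<Omega> \<Longrightarrow> k' x = k' y \<Longrightarrow> k x = k y"
  shows "energy \<Omega> k' f = energy \<Omega> k f + (\<Sum>w\<in>\<Omega>. (cell_avg \<Omega> k f w - cell_avg \<Omega> k' f w)\<^sup>2)"
proof -
  let ?a = "cell_avg \<Omega> k f" and ?b = "cell_avg \<Omega> k' f"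
  have "(\<Sum>w\<in>\<Omega>. ?a w * ?b w) = (\<Sum>w\<in>\<Omega>. ?a w * f w)"
    by (rule sum_mult_cell_avg[OF fin]) (drule ref, auto simp: cell_avg_def)
  also have "\<dots> = (\<Sum>w\<in>\<Omega>. ?a w * ?a w)"
    by (rule sum_mult_cell_avg[symmetric, OF fin]) (auto simp: cell_avg_def)
  finally have "(\<Sum>w\<in>\<Omega>. ?a w * ?b w) = (\<Sum>w\<in>\<Omega>. (?a w)\<^sup>2)" by (simp add: power2_eq_square)
  then show ?thesis
    by (simp add: energy_def power2_diff sum.distrib sum_subtractf sum_distrib_left[symmetric] mult.assoc)
qed

text \<open>A defect form of Cauchy-Schwarz. On \<open>W a\<close>, a union of fine cells, the fine
  averages have mean at most \<open>\<eta> / 2\<close> while the coarse average is at least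
  \<open>\<eta>\<close>. By \<open>energy_refine\<close> the energy then grows by at least
  \<open>\<eta>^2 / 4\<close> per point of \<open>W a\<close>.\<close>

lemma energy_increment:
  fixes \<Omega> :: "'b set" and W :: "'k \<Rightarrow> 'b set" and \<theta> :: real
  assumes fin: "finite \<Omega>" and finK: "finite K"
    and ref: "\<And>x y. x \<in> \<Omega> \<Longrightarrow> y \<in> \<Omega> \<Longrightarrow> k' x = k' y \<Longrightarrow> k x = k y"
    and sub: "\<And>a. a \<in> K \<Longrightarrow> W a \<subseteq> {w \<in> \<Omega>. k w = a}"
    and cl: "\<And>a x y. a \<in> K \<Longrightarrow> x \<in> W a \<Longrightarrow> y \<in> \<Omega> \<Longrightarrow> k' x = k' y \<Longrightarrow> y \<in> W a"
    and low: "\<And>a. a \<in> K \<Longrightarrow> (\<Sum>w\<in>W a. f w) \<le> \<eta> / 2 * card (W a)"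
    and high: "\<And>a w. a \<in> K \<Longrightarrow> w \<in> W a \<Longrightarrow> \<eta> \<le> cell_avg \<Omega> k f w"
    and big: "\<And>a. a \<in> K \<Longrightarrow> \<theta> * card {w \<in> \<Omega>. k w = a} \<le> card (W a)"
    and eta: "0 \<le> \<eta>"
  shows "energy \<Omega> k f + \<eta>\<^sup>2 / 4 * \<theta> * card {w \<in> \<Omega>. k w \<in> K} \<le> energy \<Omega> k' f"
proof -
  let ?d = "\<lambda>w. cell_avg \<Omega> k f w - cell_avg \<Omega> k' f w"
  have WO: "W a \<subseteq> \<Omega>" if "a \<in> K" for a using sub[OF that] by blast
  have W: "\<eta>\<^sup>2 / 4 * \<theta> * card {w \<in> \<Omega>. k w = a} \<le> (\<Sum>w\<in>W a. (?d w)\<^sup>2)" if a: "a \<in> K" for a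
  proof -
    \<comment> \<open>The tangent to the square at \<open>\<eta> / 2\<close> stands in for
      Cauchy-Schwarz: being linear, it can be summed over \<open>W a\<close>.\<close>
    have sq: "\<eta> * x - \<eta>\<^sup>2 / 4 \<le> x\<^sup>2" for x
      using zero_le_power2[of "x - \<eta> / 2"] by (simp add: power2_diff power_divide algebra_simps)
    have eq: "(\<Sum>w\<in>W a. cell_avg \<Omega> k' f w) = (\<Sum>w\<in>W a. f w)"
    proof (rule sum_cell_avg_closed[OF fin WO[OF a]])
      show "y \<in> W a" if "x \<in> W a" "y \<in> \<Omega>" "k' x = k' y" for x y
        using cl[OF a that] .
    qed
    have "\<eta> / 2 * card (W a) \<le> \<eta> * card (W a) - (\<Sum>w\<in>W a. f w)"
      using low[OF a] by linarith
    also have "\<dots> = (\<Sum>w\<in>W a. \<eta>) - (\<Sum>w\<in>W a. cell_avg \<Omega> k' f w)"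
      unfolding eq by simp
    also have "\<dots> \<le> (\<Sum>w\<in>W a. cell_avg \<Omega> k f w) - (\<Sum>w\<in>W a. cell_avg \<Omega> k' f w)"
      by (intro diff_right_mono sum_mono high[OF a])
    also have "\<dots> = (\<Sum>w\<in>W a. ?d w)" by (rule sum_subtractf[symmetric])
    finally have s: "\<eta> / 2 * card (W a) \<le> (\<Sum>w\<in>W a. ?d w)" .
    have "\<theta> * card {w \<in> \<Omega>. k w = a} * (\<eta>\<^sup>2 / 4) \<le> card (W a) * (\<eta>\<^sup>2 / 4)"
      by (rule mult_right_mono[OF big[OF a]]) simp
    also have "\<dots> = \<eta> * (\<eta> / 2 * card (W a)) - \<eta>\<^sup>2 / 4 * card (W a)"
      by (simp add: power2_eq_square)
    also have "\<dots> \<le> \<eta> * (\<Sum>w\<in>W a. ?d w) - \<eta>\<^sup>2 / 4 * card (W a)"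
      by (rule diff_right_mono[OF mult_left_mono[OF s eta]])
    also have "\<dots> = (\<Sum>w\<in>W a. \<eta> * ?d w - \<eta>\<^sup>2 / 4)"
      by (subst sum_subtractf) (simp add: sum_distrib_left)
    also have "\<dots> \<le> (\<Sum>w\<in>W a. (?d w)\<^sup>2)" by (rule sum_mono) (rule sq)
    finally show ?thesis by (simp add: mult_ac)
  qed
  have "card {w \<in> \<Omega>. k w \<in> K} = (\<Sum>a\<in>K. card {w \<in> \<Omega>. k w = a})"
  proof -
    have U: "{w \<in> \<Omega>. k w \<in> K} = (\<Union>a\<in>K. {w \<in> \<Omega>. k w = a})" by auto
    show ?thesis unfolding U by (rule card_UN_disjoint) (use fin finK in auto)
  qed
  then have "\<eta>\<^sup>2 / 4 * \<theta> * card {w \<in> \<Omega>. k w \<in> K} = (\<Sum>a\<in>K. \<eta>\<^sup>2 / 4 * \<theta> * card {w \<in> \<Omega>. k w = a})"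
    by (simp add: sum_distrib_left)
  also have "\<dots> \<le> (\<Sum>a\<in>K. \<Sum>w\<in>W a. (?d w)\<^sup>2)" by (rule sum_mono) (rule W)
  also have "\<dots> = (\<Sum>w\<in>(\<Union>a\<in>K. W a). (?d w)\<^sup>2)"
  proof (rule sum.UNION_disjoint[symmetric, OF finK])
    show "\<forall>a\<in>K. finite (W a)" using finite_subset[OF WO fin] by blast
    show "\<forall>a\<in>K. \<forall>b\<in>K. a \<noteq> b \<longrightarrow> W a \<inter> W b = {}"
    proof (intro ballI impI)
      fix a b assume "a \<in> K" "b \<in> K" "a \<noteq> b"
      then show "W a \<inter> W b = {}" using sub[of a] sub[of b] by blast
    qed
  qed
  also have "\<dots> \<le> (\<Sum>w\<in>\<Omega>. (?d w)\<^sup>2)"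
  proof (rule sum_mono2[OF fin])
    show "\<Union> (W ` K) \<subseteq> \<Omega>" using WO by (rule UN_least)
  qed (rule zero_le_power2)
  also have "\<dots> = energy \<Omega> k' f - energy \<Omega> k f"
  proof -
    have "energy \<Omega> k' f = energy \<Omega> k f + (\<Sum>w\<in>\<Omega>. (?d w)\<^sup>2)"
    proof (rule energy_refine[OF fin])
      show "k x = k y" if "x \<in> \<Omega>" "y \<in> \<Omega>" "k' x = k' y" for x y using ref[OF that] .
    qed
    then show ?thesis by linarith
  qed
  finally show ?thesis by linarith
qed

section \<open>Graphs whose edges lie in few triangles\<close>

lemma card_fibre_le:
  assumes "finite B" and "g ` A \<subseteq> B" and "\<And>b. b \<in> B \<Longrightarrow> card {a \<in> A. g a = b} \<le> K"
  shows "card A \<le> K * card B"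
proof -
  have "A = (\<Union>b\<in>B. {a \<in> A. g a = b})" using assms(2) by auto
  then have "card A \<le> (\<Sum>b\<in>B. card {a \<in> A. g a = b})"
    using card_UN_le[OF assms(1), of "\<lambda>b. {a \<in> A. g a = b}"] by simp
  also have "\<dots> \<le> (\<Sum>b\<in>B. K)" by (rule sum_mono) (rule assms(3))
  finally show ?thesis by (simp add: mult.commute)
qed

text \<open>One round of the energy increment. Vertices are classified by the members of
  \<open>S\<close> containing them, pairs by the classes of their ends. Discard the triangles with
  \<open>(u, v)\<close> in a sparse cell, with \<open>u\<close> or \<open>v\<close> in a small
  class, or with few neighbours of \<open>z\<close> in the class of \<open>u\<close> or of
  \<open>v\<close>. In a surviving triangle \<open>z\<close> has large neighbourhoods in both
  classes, yet few edges run between them, since an edge at \<open>z\<close> lies in at most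
  \<open>C\<close> triangles. Adding the sides of such sparse rectangles to \<open>S\<close> raises
  the energy.\<close>

lemma energy_increment_step:
  fixes E :: "('a \<times> 'a) set" and V :: "'a set" and S :: "'a set set" and \<epsilon> :: real
  assumes fin: "finite V" and EV: "E \<subseteq> V \<times> V" and sym: "sym E"
    and common: "\<And>u v. (u, v) \<in> E \<Longrightarrow> card {w. (u, w) \<in> E \<and> (v, w) \<in> E} \<le> C"
    and C: "1 \<le> C" and eps: "0 < \<epsilon>"
    and finS: "finite S" and cardS: "card S \<le> s"
    and eta: "\<eta> = \<epsilon> / (8 * real C)" and m0: "2 * real C / \<eta>\<^sup>2 \<le> m0"
    and n: "16 * real C * 2 ^ s * real m0 \<le> \<epsilon> * card V"
    and many: "\<epsilon> * (card V)\<^sup>2 < card {(z, u, v). (z, u) \<in> E \<and> (z, v) \<in> E \<and> (u, v) \<in> E}"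
  defines "q \<equiv> \<lambda>S. energy (V \<times> V) (\<lambda>(x, y). ({T \<in> S. x \<in> T}, {T \<in> S. y \<in> T})) (\<lambda>w. of_bool (w \<in> E))"
  shows "\<exists>S'. finite S' \<and> card S' \<le> s + 2 * 4 ^ s \<and> q S + \<eta>\<^sup>2 / 4 * \<eta>\<^sup>2 * (\<epsilon> / (2 * real C)) * (card V)\<^sup>2 \<le> q S'"
proof -
  define \<Omega> where "\<Omega> = V \<times> V"
  define c where "c x = {T \<in> S. x \<in> T}" for x
  define k where "k = (\<lambda>(x, y). (c x, c y))"
  define cl where "cl x = {y \<in> V. c y = c x}" for x
  define f where "f = (\<lambda>w. of_bool (w \<in> E) :: real)"
  define m where "m = cell_avg \<Omega> k f"
  define nb where "nb z = {u. (z, u) \<in> E}" for z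
  define Tri where "Tri = {(z, u, v). (z, u) \<in> E \<and> (z, v) \<in> E \<and> (u, v) \<in> E}"
  define n where "n = card V"
  have eta0: "0 < \<eta>" using eps C by (simp add: eta)
  have finO: "finite \<Omega>" using fin by (simp add: \<Omega>_def)
  have finE: "finite E" using fin EV finite_subset by blast
  have Tsub: "Tri \<subseteq> V \<times> V \<times> V" using EV by (auto simp: Tri_def)
  have finT: "finite Tri" by (rule finite_subset[OF Tsub]) (use fin in auto)
  have symE: "(u, v) \<in> E \<longleftrightarrow> (v, u) \<in> E" for u v using sym by (meson symD)
  have finc: "finite {w. (u, w) \<in> E \<and> (v, w) \<in> E}" for u v
    by (rule finite_subset[of _ V]) (use fin EV in auto)
  \<comment> \<open>Two vertices of a triangle leave at most \<open>C\<close> choices for the third,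
    so discarding a set of edges costs at most \<open>C\<close> triangles per edge;
    \<open>cnt\<close> packages this.\<close>
  have fib: "card {a \<in> A. g a = b} \<le> C"
    if "A \<subseteq> Tri" "g = (\<lambda>(z, u, v). (z, u)) \<or> g = (\<lambda>(z, u, v). (z, v)) \<or> g = (\<lambda>(z, u, v). (u, v))"
    for A and g :: "'a \<times> 'a \<times> 'a \<Rightarrow> 'a \<times> 'a" and b
  proof -
    obtain x y where b: "b = (x, y)" by fastforce
    let ?N = "{w. (x, w) \<in> E \<and> (y, w) \<in> E}"
    have "card {a \<in> A. g a = b} \<le> card ?N"
      using that(2)
    proof (elim disjE)
      assume g: "g = (\<lambda>(z, u, v). (z, u))"
      show ?thesis
        by (rule card_inj_on_le[where f = "\<lambda>(z, u, v). v"])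
          (use that(1) finc in \<open>auto simp: g b inj_on_def Tri_def\<close>)
    next
      assume g: "g = (\<lambda>(z, u, v). (z, v))"
      show ?thesis
      proof (rule card_inj_on_le[where f = "\<lambda>(z, u, v). u"])
        show "(\<lambda>(z, u, v). u) ` {a \<in> A. g a = b} \<subseteq> ?N"
          by (auto simp: g b Tri_def dest!: subsetD[OF that(1)] intro: symD[OF sym])
      qed (use finc in \<open>auto simp: g b inj_on_def\<close>)
    next
      assume g: "g = (\<lambda>(z, u, v). (u, v))"
      show ?thesis
      proof (rule card_inj_on_le[where f = "\<lambda>(z, u, v). z"])
        show "(\<lambda>(z, u, v). z) ` {a \<in> A. g a = b} \<subseteq> ?N"
          by (auto simp: g b Tri_def dest!: subsetD[OF that(1)] intro: symD[OF sym])
      qed (use finc in \<open>auto simp: g b inj_on_def\<close>)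
    qed
    moreover have "card {a \<in> A. g a = b} \<le> C" if "(x, y) \<notin> E"
    proof -
      have "{a \<in> A. g a = b} = {}"
        using \<open>A \<subseteq> Tri\<close> \<open>_ \<or> _ \<or> _\<close> that by (auto simp: b Tri_def)
      then show ?thesis by (simp only: card.empty)
    qed
    ultimately show ?thesis using common[of x y] by (cases "(x, y) \<in> E") auto
  qed
  have cnt: "real (card A) \<le> C * b"
    if "A \<subseteq> Tri" "g = (\<lambda>(z, u, v). (z, u)) \<or> g = (\<lambda>(z, u, v). (z, v)) \<or> g = (\<lambda>(z, u, v). (u, v))"
      "g ` A \<subseteq> B" "finite B" "real (card B) \<le> b" for A g B and b :: real
  proof -
    have "card A \<le> C * card B" by (rule card_fibre_le[OF that(4,3)]) (rule fib[OF that(1,2)])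
    then have "real (card A) \<le> C * real (card B)" by (metis of_nat_le_iff of_nat_mult)
    also have "\<dots> \<le> C * b" using that(5) by (intro mult_left_mono) auto
    finally show ?thesis .
  qed
  have cellk: "{w \<in> \<Omega>. k w = k (u, v)} = cl u \<times> cl v" for u v
    by (auto simp: \<Omega>_def k_def cl_def)
  have fincl: "finite (cl u)" for u using fin by (simp add: cl_def)
  have sumf: "(\<Sum>w\<in>W. f w) = card (W \<inter> E)" if "finite W" for W
    using that by (simp add: f_def of_bool_def sum.If_cases Int_def)

  \<comment> \<open>A bad cell is dense on average but contains a large sparse rectangle. The
    fraction is \<open>\<eta>^2\<close> because each side fills a fraction \<open>\<eta>\<close> of
    its class.\<close>
  define bad where "bad a \<longleftrightarrow> (\<exists>P Q. P \<subseteq> V \<and> Q \<subseteq> V \<and> P \<times> Q \<subseteq> {w \<in> \<Omega>. k w = a} \<and>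
     real (card (P \<times> Q \<inter> E)) \<le> \<eta> / 2 * card (P \<times> Q) \<and>
     (\<forall>w\<in>P \<times> Q. \<eta> \<le> m w) \<and> \<eta>\<^sup>2 * card {w \<in> \<Omega>. k w = a} \<le> card (P \<times> Q))" for a
  define K where "K = {a \<in> k ` \<Omega>. bad a}"
  have finK: "finite K" using finO by (simp add: K_def)

  have colours: "card (c ` V) \<le> 2 ^ s"
  proof -
    have "card (c ` V) \<le> card (Pow S)" by (rule card_mono) (auto simp: c_def finS)
    also have "\<dots> \<le> 2 ^ s" using cardS by (simp add: card_Pow finS)
    finally show ?thesis .
  qed
  have "K \<subseteq> c ` V \<times> c ` V" by (auto simp: K_def \<Omega>_def k_def)
  then have "card K \<le> card (c ` V \<times> c ` V)" by (rule card_mono[rotated]) (use fin in auto)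
  also have "\<dots> \<le> 2 ^ s * 2 ^ s" unfolding card_cartesian_product using colours by (rule mult_mono) (use colours in auto)
  finally have cardK: "card K \<le> 4 ^ s" by (simp add: power_mult_distrib[symmetric])

  obtain P Q where PQ: "\<And>a. a \<in> K \<Longrightarrow> P a \<subseteq> V \<and> Q a \<subseteq> V \<and> P a \<times> Q a \<subseteq> {w \<in> \<Omega>. k w = a} \<and>
     real (card (P a \<times> Q a \<inter> E)) \<le> \<eta> / 2 * card (P a \<times> Q a) \<and>
     (\<forall>w\<in>P a \<times> Q a. \<eta> \<le> m w) \<and> \<eta>\<^sup>2 * card {w \<in> \<Omega>. k w = a} \<le> card (P a \<times> Q a)"
  proof -
    have "\<forall>a\<in>K. \<exists>p. fst p \<subseteq> V \<and> snd p \<subseteq> V \<and> fst p \<times> snd p \<subseteq> {w \<in> \<Omega>. k w = a} \<and>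
     real (card (fst p \<times> snd p \<inter> E)) \<le> \<eta> / 2 * card (fst p \<times> snd p) \<and>
     (\<forall>w\<in>fst p \<times> snd p. \<eta> \<le> m w) \<and> \<eta>\<^sup>2 * card {w \<in> \<Omega>. k w = a} \<le> card (fst p \<times> snd p)"
      by (simp add: K_def bad_def)
    from bchoice[OF this] obtain p where "\<forall>a\<in>K. fst (p a) \<subseteq> V \<and> snd (p a) \<subseteq> V \<and> fst (p a) \<times> snd (p a) \<subseteq> {w \<in> \<Omega>. k w = a} \<and>
     real (card (fst (p a) \<times> snd (p a) \<inter> E)) \<le> \<eta> / 2 * card (fst (p a) \<times> snd (p a)) \<and>
     (\<forall>w\<in>fst (p a) \<times> snd (p a). \<eta> \<le> m w) \<and> \<eta>\<^sup>2 * card {w \<in> \<Omega>. k w = a} \<le> card (fst (p a) \<times> snd (p a))" ..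
    then show ?thesis using that[of "\<lambda>a. fst (p a)" "\<lambda>a. snd (p a)"] by blast
  qed
  \<comment> \<open>With both sides of a rectangle in \<open>S'\<close>, the rectangle becomes a
    union of new cells. There are at most \<open>4 ^ s\<close> cells, being pairs of at most
    \<open>2 ^ s\<close> classes.\<close>
  define S' where "S' = S \<union> P ` K \<union> Q ` K"
  have finS': "finite S'" using finS finK by (simp add: S'_def)
  have cardS': "card S' \<le> s + 2 * 4 ^ s"
  proof -
    have "card S' \<le> card S + card (P ` K) + card (Q ` K)"
      unfolding S'_def by (meson card_Un_le order_trans add_le_mono1)
    then show ?thesis using cardS cardK card_image_le[OF finK, of P] card_image_le[OF finK, of Q] by linarith
  qed
  define c' where "c' x = {T \<in> S'. x \<in> T}" for x
  define k' where "k' = (\<lambda>(x, y). (c' x, c' y))"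
  have c': "c' x = c' y \<Longrightarrow> T \<in> S' \<Longrightarrow> x \<in> T \<Longrightarrow> y \<in> T" for x y T
    unfolding c'_def by blast
  have cc': "c x = {T \<in> c' x. T \<in> S}" for x by (auto simp: c_def c'_def S'_def)
  have inc: "energy \<Omega> k f + \<eta>\<^sup>2 / 4 * \<eta>\<^sup>2 * card {w \<in> \<Omega>. k w \<in> K} \<le> energy \<Omega> k' f"
  proof (rule energy_increment[where W = "\<lambda>a. P a \<times> Q a"])
    show "k x = k y" if "k' x = k' y" for x y
      using that by (cases x, cases y) (simp add: k_def k'_def cc')
    show "y \<in> P a \<times> Q a" if "a \<in> K" "x \<in> P a \<times> Q a" "y \<in> \<Omega>" "k' x = k' y" for a x y
    proof -
      have "P a \<in> S'" "Q a \<in> S'" using that(1) by (auto simp: S'_def)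
      then show ?thesis
        using that(2,4) c'[of "fst x" "fst y" "P a"] c'[of "snd x" "snd y" "Q a"]
        by (cases x, cases y) (auto simp: k'_def)
    qed
    show "(\<Sum>w\<in>P a \<times> Q a. f w) \<le> \<eta> / 2 * card (P a \<times> Q a)" if "a \<in> K" for a
    proof -
      have "finite (P a \<times> Q a)" using PQ[OF that] fin finite_subset by blast
      then show ?thesis using PQ[OF that] by (simp add: sumf)
    qed
    show "\<eta> \<le> cell_avg \<Omega> k f w" if "a \<in> K" "w \<in> P a \<times> Q a" for a w
      using PQ[OF that(1)] that(2) unfolding m_def by blast
    show "\<eta>\<^sup>2 * card {w \<in> \<Omega>. k w = a} \<le> card (P a \<times> Q a)"
      and "P a \<times> Q a \<subseteq> {w \<in> \<Omega>. k w = a}" if "a \<in> K" for a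
      using PQ[OF that] by blast+
  qed (use finO finK eta0 in simp_all)

  have bound: "(\<epsilon> / (2 * real C)) * n\<^sup>2 \<le> card {w \<in> \<Omega>. k w \<in> K}"
  proof -
    define T1 where "T1 = {(z, u, v) \<in> Tri. m (u, v) < \<eta>}"
    define T2 where "T2 = {(z, u, v) \<in> Tri. card (cl u) < m0}"
    define T2' where "T2' = {(z, u, v) \<in> Tri. card (cl v) < m0}"
    define T3 where "T3 = {(z, u, v) \<in> Tri. card (nb z \<inter> cl u) < \<eta> * card (cl u)}"
    define T3' where "T3' = {(z, u, v) \<in> Tri. card (nb z \<inter> cl v) < \<eta> * card (cl v)}"
    define T4 where "T4 = {(z, u, v) \<in> Tri. k (u, v) \<in> K}"
    \<comment> \<open>A triangle outside the five discarded sets certifies that the cell of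
      \<open>(u, v)\<close> is bad, with the neighbourhoods of \<open>z\<close> as
      rectangle.\<close>
    have "Tri \<subseteq> T1 \<union> T2 \<union> T2' \<union> T3 \<union> T3' \<union> T4"
    proof
      fix t assume t: "t \<in> Tri"
      obtain z u v where zuv: "t = (z, u, v)" by (metis prod_cases3)
      have e: "(z, u) \<in> E" "(z, v) \<in> E" "(u, v) \<in> E" using t by (auto simp: Tri_def zuv)
      have V: "u \<in> V" "v \<in> V" using e EV by auto
      show "t \<in> T1 \<union> T2 \<union> T2' \<union> T3 \<union> T3' \<union> T4"
      proof (rule ccontr)
        assume "\<not> ?thesis"
        then have h: "\<eta> \<le> m (u, v)" "m0 \<le> card (cl u)" "m0 \<le> card (cl v)"
          "\<eta> * card (cl u) \<le> card (nb z \<inter> cl u)" "\<eta> * card (cl v) \<le> card (nb z \<inter> cl v)"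
          "k (u, v) \<notin> K"
          using t by (auto simp: T1_def T2_def T2'_def T3_def T3'_def T4_def zuv)
        let ?P = "nb z \<inter> cl u" and ?Q = "nb z \<inter> cl v"
        have finPQ: "finite ?P" "finite ?Q" using fincl by auto
        \<comment> \<open>The choice of \<open>m0\<close> makes \<open>?Q\<close> so large that
          \<open>C\<close> neighbours in it are a density of at most \<open>\<eta> / 2\<close>. Each
          \<open>p\<close> in \<open>?P\<close> has at most \<open>C\<close> neighbours in
          \<open>?Q\<close>, all of them common to \<open>z\<close> and \<open>p\<close>.\<close>
        have "2 * C / \<eta> = \<eta> * (2 * C / \<eta>\<^sup>2)" using eta0 by (simp add: power2_eq_square)
        also have "\<dots> \<le> \<eta> * card (cl v)" using m0 h(3) eta0 by (intro mult_left_mono) auto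
        also have "\<dots> \<le> card ?Q" by (rule h(5))
        finally have Q: "C \<le> \<eta> / 2 * card ?Q" using eta0 by (simp add: field_simps)
        have "card (?P \<times> ?Q \<inter> E) \<le> C * card ?P"
        proof (rule card_fibre_le[where g = fst])
          fix p assume p: "p \<in> ?P"
          have "card {a \<in> ?P \<times> ?Q \<inter> E. fst a = p} \<le> card {w. (z, w) \<in> E \<and> (p, w) \<in> E}"
            by (rule card_inj_on_le[where f = snd]) (use finc in \<open>auto simp: inj_on_def nb_def\<close>)
          also have "\<dots> \<le> C" using common[of z p] p by (simp add: nb_def)
          finally show "card {a \<in> ?P \<times> ?Q \<inter> E. fst a = p} \<le> C" .
        qed (use finPQ in auto)
        then have "real (card (?P \<times> ?Q \<inter> E)) \<le> C * real (card ?P)" by (metis of_nat_le_iff of_nat_mult)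
        also have "\<dots> \<le> \<eta> / 2 * card ?Q * real (card ?P)" using Q by (intro mult_right_mono) auto
        finally have low: "real (card (?P \<times> ?Q \<inter> E)) \<le> \<eta> / 2 * card (?P \<times> ?Q)"
          by (simp add: card_cartesian_product mult_ac)
        have big: "\<eta>\<^sup>2 * card (cl u \<times> cl v) \<le> card (?P \<times> ?Q)"
          using mult_mono[OF h(4,5)] eta0 by (simp add: card_cartesian_product power2_eq_square mult_ac)
        have mm: "m w = m (u, v)" if "w \<in> cl u \<times> cl v" for w
        proof -
          have "k w = k (u, v)" using that by (auto simp: cellk[symmetric])
          then show ?thesis by (simp add: m_def cell_avg_def)
        qed
        have "bad (k (u, v))" unfolding bad_def cellk
          by (rule exI[of _ ?P], rule exI[of _ ?Q]) (use low big mm h(1) in \<open>auto simp: cl_def\<close>)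
        then show False using h(6) V by (auto simp: K_def \<Omega>_def)
      qed
    qed
    then have "card Tri \<le> card (T1 \<union> T2 \<union> T2' \<union> T3 \<union> T3' \<union> T4)"
      by (rule card_mono[rotated])
        (auto intro: finite_subset[OF _ finT] simp: T1_def T2_def T2'_def T3_def T3'_def T4_def)
    also have "\<dots> \<le> card T1 + card T2 + card T2' + card T3 + card T3' + card T4"
      by (intro order_trans[OF card_Un_le] add_mono order_refl)
    finally have total: "real (card Tri) \<le> card T1 + card T2 + card T2' + card T3 + card T3' + card T4"
      by linarith
    have cardO: "card \<Omega> = n\<^sup>2" by (simp add: \<Omega>_def n_def power2_eq_square card_cartesian_product)
    have low1: "real (card {w \<in> \<Omega>. w \<in> E \<and> m w < \<eta>}) \<le> \<eta> * n\<^sup>2"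
      using card_low_cell_avg_le[OF finO, of \<eta> "\<lambda>w. w \<in> E" k] eta0
      by (simp add: m_def f_def cardO)
    have t1: "card T1 \<le> C * (\<eta> * n\<^sup>2)"
      by (rule cnt[where g = "\<lambda>(z, u, v). (u, v)", OF _ _ _ _ low1])
        (use EV finO in \<open>auto simp: T1_def Tri_def \<Omega>_def\<close>)
    define sm where "sm = {u \<in> V. card (cl u) < m0}"
    have "card sm \<le> m0 * card (c ` V)"
    proof (rule card_fibre_le[where g = c])
      fix b
      show "card {a \<in> sm. c a = b} \<le> m0"
      proof (cases "\<exists>a0\<in>sm. c a0 = b")
        case True
        then obtain a0 where a0: "a0 \<in> sm" "c a0 = b" by auto
        have "card {a \<in> sm. c a = b} \<le> card (cl a0)"
          by (rule card_mono) (use fincl a0 in \<open>auto simp: sm_def cl_def\<close>)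
        then show ?thesis using a0 by (simp add: sm_def)
      next
        case False
        then have "{a \<in> sm. c a = b} = {}" by auto
        then show ?thesis by (simp only: card.empty)
      qed
    qed (use fin in \<open>auto simp: sm_def\<close>)
    also have "\<dots> \<le> m0 * 2 ^ s" using colours by simp
    finally have "real (card sm) \<le> real (m0 * 2 ^ s)" by (simp only: of_nat_le_iff)
    then have "real (card (V \<times> sm)) \<le> n * real (m0 * 2 ^ s)"
      unfolding card_cartesian_product of_nat_mult n_def by (intro mult_left_mono) auto
    also have "\<dots> \<le> \<epsilon> * n / (16 * real C) * n"
      using assms(11) C mult_right_mono[of "16 * real C * 2 ^ s * real m0" "\<epsilon> * n" "real n"]
      by (simp add: n_def field_simps)
    finally have low2: "real (card (V \<times> sm)) \<le> \<epsilon> * n / (16 * real C) * n" .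
    have t2: "card T2 \<le> C * (\<epsilon> * n / (16 * real C) * n)"
      by (rule cnt[where g = "\<lambda>(z, u, v). (z, u)", OF _ _ _ _ low2])
        (use EV fin in \<open>auto simp: T2_def Tri_def sm_def\<close>)
    have t2': "card T2' \<le> C * (\<epsilon> * n / (16 * real C) * n)"
      by (rule cnt[where g = "\<lambda>(z, u, v). (z, v)", OF _ _ _ _ low2])
        (use EV fin in \<open>auto simp: T2'_def Tri_def sm_def\<close>)
    \<comment> \<open>The same clean-up one dimension lower: the partition of \<open>V\<close> by
      \<open>c\<close>, with the indicator of the neighbourhood of \<open>z\<close>.\<close>
    define sp where "sp z = {u \<in> V. (z, u) \<in> E \<and> card (nb z \<inter> cl u) < \<eta> * card (cl u)}" for z
    have spz: "real (card (sp z)) \<le> \<eta> * n" for z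
    proof -
      have "cell_avg V c (\<lambda>u. of_bool ((z, u) \<in> E)) u = card (nb z \<inter> cl u) / card (cl u)" for u
        using fin by (simp add: cell_avg_def cl_def nb_def of_bool_def sum.If_cases Int_def conj_commute)
      moreover have "card (cl u) > 0" if "u \<in> V" for u
        using that fincl[of u] by (auto simp: card_gt_0_iff cl_def)
      ultimately have "sp z = {u \<in> V. (z, u) \<in> E \<and> cell_avg V c (\<lambda>u. of_bool ((z, u) \<in> E)) u < \<eta>}"
        unfolding sp_def by (auto simp: field_simps)
      then show ?thesis
        using card_low_cell_avg_le[OF fin, of \<eta> "\<lambda>u. (z, u) \<in> E" c] eta0 by (simp add: n_def)
    qed
    have "real (card (Sigma V sp)) = (\<Sum>z\<in>V. real (card (sp z)))"
      using fin by (subst card_SigmaI) (auto simp: sp_def)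
    also have "\<dots> \<le> (\<Sum>z\<in>V. \<eta> * n)" by (rule sum_mono) (rule spz)
    also have "\<dots> = \<eta> * n\<^sup>2" by (simp add: n_def power2_eq_square)
    finally have low3: "real (card (Sigma V sp)) \<le> \<eta> * n\<^sup>2" .
    have finsp: "finite (Sigma V sp)" using fin by (auto simp: sp_def)
    have t3: "card T3 \<le> C * (\<eta> * n\<^sup>2)"
      by (rule cnt[where g = "\<lambda>(z, u, v). (z, u)", OF _ _ _ finsp low3])
        (use EV in \<open>auto simp: T3_def Tri_def sp_def\<close>)
    have t3': "card T3' \<le> C * (\<eta> * n\<^sup>2)"
      by (rule cnt[where g = "\<lambda>(z, u, v). (z, v)", OF _ _ _ finsp low3])
        (use EV in \<open>auto simp: T3'_def Tri_def sp_def\<close>)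
    have t4: "card T4 \<le> C * real (card {w \<in> \<Omega>. k w \<in> K})"
      by (rule cnt[where g = "\<lambda>(z, u, v). (u, v)", OF _ _ _ _ order_refl])
        (use EV finO in \<open>auto simp: T4_def Tri_def \<Omega>_def\<close>)
    have many': "\<epsilon> * n\<^sup>2 < card Tri" using many by (simp add: Tri_def n_def)
    have e1: "C * (\<eta> * n\<^sup>2) = \<epsilon> / 8 * n\<^sup>2" using C by (simp add: eta)
    have e2: "C * (\<epsilon> * n / (16 * real C) * n) = \<epsilon> / 16 * n\<^sup>2" using C by (simp add: power2_eq_square)
    \<comment> \<open>The discarded triangles amount to at most half of
      \<open>\<epsilon> * n^2\<close>, so the bad cells carry at least the other half.\<close>
    have "\<epsilon> * n\<^sup>2 < \<epsilon> / 8 * n\<^sup>2 + \<epsilon> / 16 * n\<^sup>2 + \<epsilon> / 16 * n\<^sup>2 + \<epsilon> / 8 * n\<^sup>2 + \<epsilon> / 8 * n\<^sup>2 + C * real (card {w \<in> \<Omega>. k w \<in> K})"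
      using total t1 t2 t2' t3 t3' t4 many' unfolding e1 e2 by linarith
    moreover have "0 \<le> \<epsilon> * n\<^sup>2" using eps by simp
    ultimately have "\<epsilon> / 2 * n\<^sup>2 \<le> C * real (card {w \<in> \<Omega>. k w \<in> K})"
      by linarith
    then show ?thesis using C by (simp add: field_simps)
  qed
  have "\<eta>\<^sup>2 / 4 * \<eta>\<^sup>2 * ((\<epsilon> / (2 * real C)) * n\<^sup>2) \<le> \<eta>\<^sup>2 / 4 * \<eta>\<^sup>2 * card {w \<in> \<Omega>. k w \<in> K}"
    by (rule mult_left_mono[OF bound]) simp
  moreover have "q S = energy \<Omega> k f"
    unfolding q_def \<Omega>_def k_def c_def f_def by (rule refl)
  moreover have "q S' = energy \<Omega> k' f"
    unfolding q_def \<Omega>_def k'_def c'_def f_def by (rule refl)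
  ultimately have "q S + \<eta>\<^sup>2 / 4 * \<eta>\<^sup>2 * (\<epsilon> / (2 * real C)) * (card V)\<^sup>2 \<le> q S'"
    using inc unfolding n_def mult.assoc by linarith
  then show ?thesis using finS' cardS' by blast
qed

text \<open>The Ruzsa-Szemeredi theorem in bounded-multiplicity form. As long as there are too many
  triangles, each round gains a fixed fraction \<open>\<gamma>\<close> of the squared order, whereas
  the energy never exceeds the squared order.\<close>

lemma few_triangles:
  fixes \<epsilon> :: real and C :: nat
  assumes C: "1 \<le> C" and eps: "0 < \<epsilon>"
  shows "\<exists>N. \<forall>(V :: 'a set) E. finite V \<and> N \<le> card V \<and> E \<subseteq> V \<times> V \<and> sym E \<and>
      (\<forall>u v. (u, v) \<in> E \<longrightarrow> card {w. (u, w) \<in> E \<and> (v, w) \<in> E} \<le> C) \<longrightarrow>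
      card {(z, u, v). (z, u) \<in> E \<and> (z, v) \<in> E \<and> (u, v) \<in> E} \<le> \<epsilon> * (card V)\<^sup>2"
proof -
  define \<eta> where "\<eta> = \<epsilon> / (8 * real C)"
  define \<gamma> where "\<gamma> = \<eta>\<^sup>2 / 4 * \<eta>\<^sup>2 * (\<epsilon> / (2 * real C))"
  define m0 where "m0 = nat \<lceil>2 * real C / \<eta>\<^sup>2\<rceil>"
  have m0: "2 * real C / \<eta>\<^sup>2 \<le> m0" unfolding m0_def by (rule real_nat_ceiling_ge)
  have g0: "0 < \<gamma>" using C eps by (simp add: \<gamma>_def \<eta>_def)
  define ok where "ok V E \<longleftrightarrow> finite V \<and> E \<subseteq> V \<times> V \<and> sym E \<and>
      (\<forall>u v. (u, v) \<in> E \<longrightarrow> card {w. (u, w) \<in> E \<and> (v, w) \<in> E} \<le> C) \<and>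
      \<epsilon> * (card V)\<^sup>2 < card {(z, u, v). (z, u) \<in> E \<and> (z, v) \<in> E \<and> (u, v) \<in> E}"
    for V :: "'a set" and E
  define q where "q V E S = energy (V \<times> V) (\<lambda>(x, y). ({T \<in> S. x \<in> T}, {T \<in> S. y \<in> T})) (\<lambda>w. of_bool (w \<in> E))"
    for V :: "'a set" and E and S :: "'a set set"
  \<comment> \<open>\<open>s\<close> and \<open>N\<close> are fixed before \<open>V\<close> and
    \<open>E\<close>: the bound on the number of sets after \<open>i\<close> rounds, and hence the
    order needed for the next round, must be uniform.\<close>
  have step: "\<exists>s N. \<forall>V E. ok V E \<and> N \<le> card V \<longrightarrow>
      (\<exists>S. finite S \<and> card S \<le> s \<and> i * \<gamma> * (card V)\<^sup>2 \<le> q V E S)" for i :: nat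
  proof (induction i)
    case 0
    have "finite {} \<and> card {} \<le> 0 \<and> real 0 * \<gamma> * (card V)\<^sup>2 \<le> q V E {}" for V E
      by (simp add: q_def energy_nonneg)
    then show ?case by blast
  next
    case (Suc i)
    then obtain s N where IH: "\<And>V E. ok V E \<Longrightarrow> N \<le> card V \<Longrightarrow>
      (\<exists>S. finite S \<and> card S \<le> s \<and> i * \<gamma> * (card V)\<^sup>2 \<le> q V E S)" by blast
    define N' where "N' = max N (nat \<lceil>16 * real C * 2 ^ s * real m0 / \<epsilon>\<rceil>)"
    have "\<exists>S. finite S \<and> card S \<le> s + 2 * 4 ^ s \<and> Suc i * \<gamma> * (card V)\<^sup>2 \<le> q V E S"
      if ok: "ok V E" and N': "N' \<le> card V" for V E
    proof -
      have "N \<le> card V" using N' by (simp add: N'_def)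
      from IH[OF ok this] obtain S where
        S: "finite S" "card S \<le> s" "i * \<gamma> * (card V)\<^sup>2 \<le> q V E S" by blast
      have "16 * real C * 2 ^ s * real m0 / \<epsilon> \<le> N'"
        unfolding N'_def using real_nat_ceiling_ge[of "16 * real C * 2 ^ s * real m0 / \<epsilon>"] by linarith
      also have "\<dots> \<le> card V" using N' by simp
      finally have n: "16 * real C * 2 ^ s * real m0 \<le> \<epsilon> * card V" using eps by (simp add: field_simps)
      have "\<exists>S'. finite S' \<and> card S' \<le> s + 2 * 4 ^ s \<and> q V E S + \<gamma> * (card V)\<^sup>2 \<le> q V E S'"
        unfolding q_def \<gamma>_def
      proof (rule energy_increment_step)
        show "1 \<le> C" "0 < \<epsilon>" "finite S" "card S \<le> s" "\<eta> = \<epsilon> / (8 * real C)" 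
          "2 * real C / \<eta>\<^sup>2 \<le> m0" "16 * real C * 2 ^ s * real m0 \<le> \<epsilon> * card V"
          using C eps S \<eta>_def m0 n by simp_all
      qed (use ok in \<open>simp_all add: ok_def\<close>)
      then obtain S' where "finite S'" "card S' \<le> s + 2 * 4 ^ s" "q V E S + \<gamma> * (card V)\<^sup>2 \<le> q V E S'"
        by blast
      then show ?thesis using S(3) by (intro exI[of _ S']) (simp add: algebra_simps)
    qed
    then show ?case by blast
  qed
  \<comment> \<open>So many rounds would push the energy beyond its maximum.\<close>
  obtain i :: nat where i: "1 < i * \<gamma>" using g0 by (metis reals_Archimedean3)
  obtain s N where sN: "\<And>V E. ok V E \<Longrightarrow> N \<le> card V \<Longrightarrow>
      (\<exists>S. finite S \<and> card S \<le> s \<and> i * \<gamma> * (card V)\<^sup>2 \<le> q V E S)" using step[of i] by blast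
  have "\<not> ok V E" if "max N 1 \<le> card V" for V E
  proof
    assume ok: "ok V E"
    have "N \<le> card V" using that by simp
    from sN[OF ok this] obtain S where S: "i * \<gamma> * (card V)\<^sup>2 \<le> q V E S" by blast
    have "q V E S \<le> card (V \<times> V)"
      unfolding q_def by (rule energy_le_card) (use ok in \<open>auto simp: ok_def\<close>)
    with S have "i * \<gamma> * (card V)\<^sup>2 \<le> 1 * (card V)\<^sup>2" by (simp add: card_cartesian_product power2_eq_square)
    moreover have "1 * real ((card V)\<^sup>2) < i * \<gamma> * (card V)\<^sup>2"
      by (rule mult_strict_right_mono[OF i]) (use that in auto)
    ultimately show False by simp
  qed
  then show ?thesis unfolding ok_def by (intro exI[of _ "max N 1"]) (meson not_le)
qed

section \<open>Traces of books\<close>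

text \<open>In the digraph with arcs from \<open>p\<close> to \<open>f p\<close> and
  \<open>g p\<close> the in-degrees average at most 2. A point of in-degree at most 2 has at most
  four neighbours; choosing it and deleting these five points leaves room for the induction.\<close>

lemma independent_of_two_maps:
  assumes "finite Q" and "5 * t \<le> card Q" and "\<And>p. p \<in> Q \<Longrightarrow> f p \<noteq> p \<and> g p \<noteq> p"
  shows "\<exists>S\<subseteq>Q. card S = t \<and> (\<forall>p\<in>S. f p \<notin> S \<and> g p \<notin> S)"
  using assms
proof (induction t arbitrary: Q)
  case 0
  then show ?case by (intro exI[of _ "{}"]) auto
next
  case (Suc t)
  have fin: "finite Q" by fact
  let ?I = "\<lambda>p. {q \<in> Q. f q = p} \<union> {q \<in> Q. g q = p}"
  have "\<exists>p\<in>Q. card {q \<in> Q. f q = p} + card {q \<in> Q. g q = p} \<le> 2"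
  proof (rule ccontr)
    assume "\<not> ?thesis"
    then have "(\<Sum>p\<in>Q. 3) \<le> (\<Sum>p\<in>Q. card {q \<in> Q. f q = p} + card {q \<in> Q. g q = p})"
      by (intro sum_mono) (auto simp: not_le)
    moreover have "(\<Sum>p\<in>Q. card {q \<in> Q. k q = p}) \<le> card Q" for k :: "'a \<Rightarrow> 'a"
    proof -
      have "(\<Sum>p\<in>Q. card {q \<in> Q. k q = p}) = card (\<Union>p\<in>Q. {q \<in> Q. k q = p})"
        by (rule card_UN_disjoint[symmetric]) (use fin in auto)
      also have "\<dots> \<le> card Q" by (rule card_mono) (use fin in auto)
      finally show ?thesis .
    qed
    from this[of f] this[of g] have "(\<Sum>p\<in>Q. card {q \<in> Q. f q = p} + card {q \<in> Q. g q = p}) \<le> 2 * card Q"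
      by (simp add: sum.distrib)
    ultimately have "3 * card Q \<le> 2 * card Q" by simp
    then show False using Suc.prems(2) by simp
  qed
  then obtain p where p: "p \<in> Q" "card {q \<in> Q. f q = p} + card {q \<in> Q. g q = p} \<le> 2" by blast
  define X where "X = {p, f p, g p} \<union> ?I p"
  have "card X \<le> card {p, f p, g p} + card (?I p)" unfolding X_def by (rule card_Un_le)
  also have "card {p, f p, g p} \<le> 3" by (simp add: card_insert_if)
  also have "card (?I p) \<le> 2" using p(2) card_Un_le[of "{q \<in> Q. f q = p}" "{q \<in> Q. g q = p}"] by linarith
  finally have "card X \<le> 5" by simp
  moreover have "finite X" using fin by (simp add: X_def)
  ultimately have "5 * t \<le> card (Q - X)"
    using Suc.prems(2) diff_card_le_card_Diff[of X Q] by simp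
  then obtain S where S: "S \<subseteq> Q - X" "card S = t" "\<forall>p\<in>S. f p \<notin> S \<and> g p \<notin> S"
    using Suc.IH[of "Q - X"] fin Suc.prems(3) by auto
  have "finite S" using S(1) fin finite_subset by blast
  show ?case
  proof (intro exI[of _ "insert p S"] conjI ballI)
    show "insert p S \<subseteq> Q" using S p by auto
    have "p \<notin> S" using S(1) by (auto simp: X_def)
    then show "card (insert p S) = Suc t" using S(2) \<open>finite S\<close> by simp
  next
    fix q assume "q \<in> insert p S"
    then show "f q \<notin> insert p S" "g q \<notin> insert p S"
      using S p Suc.prems(3)[of p] by (auto simp: X_def)
  qed
qed

lemma contains_traceI:
  assumes "inj_on \<phi> V" and "\<And>e. e \<in> E \<Longrightarrow> e \<subseteq> V"
    and "\<And>e. e \<in> E \<Longrightarrow> \<exists>h\<in>H. h \<inter> \<phi> ` V = \<phi> ` e"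
  shows "contains_trace H V E"
proof -
  from assms(3) obtain f where f: "\<And>e. e \<in> E \<Longrightarrow> f e \<in> H \<and> f e \<inter> \<phi> ` V = \<phi> ` e" by metis
  have "inj_on f E"
  proof (rule inj_onI)
    fix e e' assume "e \<in> E" "e' \<in> E" "f e = f e'"
    then have "\<phi> ` e = \<phi> ` e'" using f by metis
    then show "e = e'" using inj_on_image_eq_iff[OF assms(1)] assms(2) \<open>e \<in> E\<close> \<open>e' \<in> E\<close> by blast
  qed
  then show ?thesis unfolding contains_trace_def using assms(1) f by blast
qed

text \<open>The possible pages of a book with spine \<open>u v\<close>, up to collisions between pages and
  the third vertices of the chosen hyperedges.\<close>

definition pages :: "'a set set \<Rightarrow> 'a \<Rightarrow> 'a \<Rightarrow> 'a set" where
  "pages H u v = {p. (\<exists>w. w \<noteq> v \<and> {u, p, w} \<in> H) \<and> (\<exists>w. w \<noteq> u \<and> {v, p, w} \<in> H)}"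

lemma card_3_distinct: "card {x, y, z} = 3 \<longleftrightarrow> x \<noteq> y \<and> x \<noteq> z \<and> y \<noteq> z"
  by (auto simp: card_insert_if)

text \<open>A page \<open>p\<close> needs hyperedges \<open>{u, p, a p}\<close> and
  \<open>{v, p, b p}\<close> whose third vertices avoid the book. The spine is avoided by the
  definition of \<open>pages\<close>, and the other pages by \<open>independent_of_two_maps\<close>.
  The extra 1 pays for removing \<open>w\<close>, the third vertex of the hyperedge on the
  spine.\<close>

lemma contains_book_trace:
  assumes H3: "\<And>h. h \<in> H \<Longrightarrow> card h = 3"
    and uvw: "{u, v, w} \<in> H" and many: "5 * t + 1 \<le> card (pages H u v)"
  shows "contains_trace H (book_V t) (book_E t)"
proof -
  let ?Q = "pages H u v - {w}"
  have fin: "finite (pages H u v)" using many card.infinite by fastforce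
  have dist: "x \<noteq> y" "x \<noteq> z" "y \<noteq> z" if "{x, y, z} \<in> H" for x y z
    using H3[OF that] by (auto simp: card_3_distinct)
  have "\<exists>a b. a \<noteq> v \<and> {u, p, a} \<in> H \<and> b \<noteq> u \<and> {v, p, b} \<in> H" if "p \<in> ?Q" for p
    using that by (auto simp: pages_def)
  then obtain a b where ab: "\<And>p. p \<in> ?Q \<Longrightarrow> a p \<noteq> v \<and> {u, p, a p} \<in> H \<and> b p \<noteq> u \<and> {v, p, b p} \<in> H"
    by metis
  have "5 * t \<le> card ?Q" using many fin by (auto simp: card_Diff_singleton_if)
  moreover have "a p \<noteq> p \<and> b p \<noteq> p" if "p \<in> ?Q" for p using ab[OF that] dist by metis
  ultimately obtain S where S: "S \<subseteq> ?Q" "card S = t" "\<And>p. p \<in> S \<Longrightarrow> a p \<notin> S \<and> b p \<notin> S"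
    using independent_of_two_maps[of ?Q t a b] fin by auto
  have finS: "finite S" using S(1) fin finite_subset by blast
  have uvS: "u \<notin> S" "v \<notin> S" "u \<noteq> v" "w \<notin> S" "w \<noteq> u" "w \<noteq> v"
    using S(1) ab dist uvw by (blast, blast, metis, blast, metis, metis)
  obtain c where c: "bij_betw c {0..<t} S"
    using ex_bij_betw_nat_finite[OF finS] S(2) by auto
  define \<phi> where "\<phi> i = (if i = 0 then u else if i = 1 then v else c (i - 2))" for i :: nat
  have \<phi>01: "\<phi> 0 = u" "\<phi> 1 = v" by (simp_all add: \<phi>_def)
  have cS: "\<phi> i \<in> S" if "i \<in> {2..t+1}" for i
    using that bij_betwE[OF c] by (auto simp: \<phi>_def)
  have V: "book_V t = {0, 1} \<union> {2..t+1}" by (auto simp: book_V_def)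
  have img: "\<phi> ` {2..t+1} = S"
  proof
    show "\<phi> ` {2..t+1} \<subseteq> S" using cS by auto
    show "S \<subseteq> \<phi> ` {2..t+1}"
    proof
      fix s assume "s \<in> S"
      then obtain j where "j < t" "s = c j" using bij_betw_imp_surj_on[OF c] by auto
      then show "s \<in> \<phi> ` {2..t+1}" by (intro image_eqI[of _ _ "j + 2"]) (auto simp: \<phi>_def)
    qed
  qed
  have imgV: "\<phi> ` book_V t = {u, v} \<union> S" unfolding V image_Un img by (auto simp: \<phi>_def)
  show ?thesis
  proof (rule contains_traceI)
    have "inj_on \<phi> {2..t+1}"
    proof (rule inj_onI)
      fix x y assume "x \<in> {2..t+1}" "y \<in> {2..t+1}" "\<phi> x = \<phi> y"
      then have "x - 2 = y - 2"
        using inj_onD[OF bij_betw_imp_inj_on[OF c], of "x - 2" "y - 2"] by (auto simp: \<phi>_def)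
      then show "x = y" using \<open>x \<in> _\<close> \<open>y \<in> _\<close> by auto
    qed
    moreover have "\<phi> ` ({0, 1} - {2..t+1}) \<inter> \<phi> ` ({2..t+1} - {0, 1}) = {}"
    proof -
      have "\<phi> ` {0, 1} \<inter> \<phi> ` {2..t+1} = {}" unfolding img using uvS by (simp add: \<phi>01[simplified])
      then show ?thesis by blast
    qed
    moreover have "inj_on \<phi> {0, 1}" using uvS by (simp add: \<phi>01[simplified])
    ultimately show "inj_on \<phi> (book_V t)"
      unfolding V inj_on_Un by blast
    show "e \<subseteq> book_V t" if "e \<in> book_E t" for e
      using that by (auto simp: book_E_def book_V_def)
    fix e assume "e \<in> book_E t"
    then consider "e = {0, 1}" | i where "i \<in> {2..t+1}" "e = {0, i}" | i where "i \<in> {2..t+1}" "e = {1, i}"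
      unfolding book_E_def by blast
    then show "\<exists>h\<in>H. h \<inter> \<phi> ` book_V t = \<phi> ` e"
    proof cases
      case 1
      show ?thesis unfolding imgV 1 by (rule bexI[OF _ uvw]) (use uvS in \<open>auto simp: \<phi>01[simplified]\<close>)
    next
      case 2
      let ?p = "\<phi> i"
      have p: "?p \<in> S" "?p \<in> ?Q" using cS[OF 2(1)] S(1) by auto
      have "{u, ?p, a ?p} \<inter> ({u, v} \<union> S) = {u, ?p}"
        using p ab[OF p(2)] S(3)[OF p(1)] uvS by auto
      then have "{u, ?p, a ?p} \<inter> \<phi> ` book_V t = \<phi> ` e" unfolding imgV 2(2) by (simp add: \<phi>01[simplified])
      then show ?thesis by (rule bexI) (use ab[OF p(2)] in blast)
    next
      case 3
      let ?p = "\<phi> i"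
      have p: "?p \<in> S" "?p \<in> ?Q" using cS[OF 3(1)] S(1) by auto
      have "{v, ?p, b ?p} \<inter> ({u, v} \<union> S) = {v, ?p}"
        using p ab[OF p(2)] S(3)[OF p(1)] uvS by auto
      then have "{v, ?p, b ?p} \<inter> \<phi> ` book_V t = \<phi> ` e" unfolding imgV 3(2) by (simp add: \<phi>01[simplified])
      then show ?thesis by (rule bexI) (use ab[OF p(2)] in blast)
    qed
  qed
qed

text \<open>A book contains a triangle. The centre \<open>n - 1\<close> lies in every hyperedge, so
  as a book vertex it would lie on all three sides. If it is not a book vertex, the sides are edges
  of a bipartite graph.\<close>

lemma star_bip_trace_free:
  assumes "1 \<le> t"
  shows "\<not> contains_trace (star_bip n) (book_V t) (book_E t)"
proof
  assume "contains_trace (star_bip n) (book_V t) (book_E t)"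
  then obtain \<phi> f where inj: "inj_on \<phi> (book_V t)"
    and all: "\<forall>e\<in>book_E t. f e \<in> star_bip n \<and> f e \<inter> \<phi> ` book_V t = \<phi> ` e"
    unfolding contains_trace_def by (elim exE conjE)
  have f: "f e \<in> star_bip n \<and> f e \<inter> \<phi> ` book_V t = \<phi> ` e" if "e \<in> book_E t" for e
    using all that by (rule bspec)
  let ?m = "(n - 1) div 2"
  have V: "0 \<in> book_V t" "1 \<in> book_V t" "2 \<in> book_V t" using assms by (auto simp: book_V_def)
  have ne: "\<phi> 0 \<noteq> \<phi> 1" "\<phi> 0 \<noteq> \<phi> 2" "\<phi> 1 \<noteq> \<phi> 2"
    using inj_onD[OF inj _ V(1,2)] inj_onD[OF inj _ V(1,3)] inj_onD[OF inj _ V(2,3)] by auto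
  have E: "{0, 1} \<in> book_E t" "{0, 2} \<in> book_E t" "{1, 2} \<in> book_E t"
    using assms by (auto simp: book_E_def)
  have z: "n - 1 \<in> f e" if "e \<in> book_E t" for e
    using f[OF that] by (auto simp: star_bip_def)
  have "n - 1 \<notin> \<phi> ` book_V t"
  proof
    assume "n - 1 \<in> \<phi> ` book_V t"
    then have "n - 1 \<in> \<phi> ` e" if "e \<in> book_E t" for e using z[OF that] f[OF that] by blast
    from this[OF E(1)] this[OF E(2)] this[OF E(3)] show False using ne by auto
  qed
  then have side: "(\<phi> x < ?m) \<noteq> (\<phi> y < ?m)" if e: "{x, y} \<in> book_E t" "x \<in> book_V t" "y \<in> book_V t" "\<phi> x \<noteq> \<phi> y" for x y
  proof -
    obtain a b where ab: "f {x, y} = {a, b, n - 1}" "a < ?m" "?m \<le> b"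
      using f[OF e(1)] by (auto simp: star_bip_def)
    have "\<phi> x \<in> {a, b, n - 1}" "\<phi> y \<in> {a, b, n - 1}" "\<phi> x \<noteq> n - 1" "\<phi> y \<noteq> n - 1"
      using f[OF e(1)] ab(1) \<open>n - 1 \<notin> _\<close> e(2,3) by auto
    then show ?thesis using ab(2,3) e(4) by auto
  qed
  from side[OF E(1) V(1,2) ne(1)] side[OF E(2) V(1,3) ne(2)] side[OF E(3) V(2,3) ne(3)]
  show False by auto
qed

lemma star_bip_image:
  "star_bip n = (\<lambda>(a, b). {a, b, n - 1}) ` ({..<(n - 1) div 2} \<times> {(n - 1) div 2..<n - 1})"
  unfolding star_bip_def by (auto simp: image_iff simp del: One_nat_def) blast

lemma card_star_bip: "card (star_bip n) = (n - 1)\<^sup>2 div 4"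
proof -
  let ?m = "(n - 1) div 2"
  have "inj_on (\<lambda>(a, b). {a, b, n - 1}) ({..<?m} \<times> {?m..<n - 1})"
    by (auto simp: inj_on_def doubleton_eq_iff insert_eq_iff)
  then have "card (star_bip n) = ?m * (n - 1 - ?m)"
    unfolding star_bip_image by (simp add: card_image)
  also have "\<dots> = (n - 1)\<^sup>2 div 4"
  proof (cases "even (n - 1)")
    case True
    then obtain k where "n - 1 = 2 * k" by (elim evenE)
    then show ?thesis by (simp add: power2_eq_square)
  next
    case False
    then obtain k where k: "n - 1 = 2 * k + 1" by (elim oddE)
    have "(2 * k + 1)\<^sup>2 = 4 * (k * (k + 1)) + 1" by (simp add: power2_eq_square algebra_simps)
    then show ?thesis unfolding k by simp
  qed
  finally show ?thesis .
qed

lemma uniform3_on_star_bip: "uniform3_on n (star_bip n)"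
  by (auto simp: uniform3_on_def star_bip_def card_insert_if)

section \<open>The graph of private pairs\<close>

text \<open>Trace-freeness enters the counting through the bound on \<open>pages\<close>; for the
  book, \<open>C\<close> is \<open>5 * t\<close>.\<close>

locale sparse_triples =
  fixes V :: "'a set" and H :: "'a set set" and C :: nat
  assumes finV: "finite V" and H3: "\<And>h. h \<in> H \<Longrightarrow> h \<subseteq> V \<and> card h = 3"
    and pages_le: "\<And>u v w. {u, v, w} \<in> H \<Longrightarrow> card (pages H u v) \<le> C"
begin

abbreviation "n \<equiv> real (card V)"

definition owns :: "'a set \<Rightarrow> 'a set \<Rightarrow> bool" where
  "owns h g \<longleftrightarrow> h \<in> H \<and> g \<subseteq> h \<and> card g = 2 \<and> (\<forall>h'\<in>H. g \<subseteq> h' \<longrightarrow> h' = h)"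

definition own :: "'a set \<Rightarrow> 'a set" where
  "own h = (SOME g. owns h g)"

definition G :: "'a set set" where
  "G = own ` {h. \<exists>g. owns h g}"

definition B :: "'a set set" where
  "B = {h \<in> H. \<not> (\<exists>g. owns h g)}"

definition N :: "'a \<Rightarrow> 'a set" where
  "N v = {w. {v, w} \<in> G}"

abbreviation "deg v \<equiv> card (N v)"

lemma finH: "finite H"
proof (rule finite_subset)
  show "H \<subseteq> Pow V" using H3 by auto
qed (simp add: finV)

lemma B_subset: "B \<subseteq> H" by (auto simp: B_def)

lemma finB: "finite B" using finite_subset[OF B_subset finH] .

lemma H_distinct: "{x, y, z} \<in> H \<Longrightarrow> x \<noteq> y \<and> x \<noteq> z \<and> y \<noteq> z"
  using H3[of "{x, y, z}"] by (simp add: card_3_distinct)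

lemma H_in_V: "{x, y, z} \<in> H \<Longrightarrow> x \<in> V \<and> y \<in> V \<and> z \<in> V"
  using H3[of "{x, y, z}"] by simp

lemma H_elem_third:
  assumes "h \<in> H" "u \<in> h" "v \<in> h" "u \<noteq> v"
  obtains w where "h = {u, v, w}" "w \<noteq> u" "w \<noteq> v"
proof -
  have "finite h" using H3[OF assms(1)] finV finite_subset by blast
  have "card (h - {u, v}) = 1"
    using H3[OF assms(1)] assms \<open>finite h\<close> by (simp add: card_Diff_subset)
  then obtain w where "h - {u, v} = {w}" by (auto simp: card_1_singleton_iff)
  then have "h = {u, v, w}" "w \<noteq> u" "w \<noteq> v" using assms by auto
  then show thesis by (rule that)
qed

lemma owns_own: "\<exists>g. owns h g \<Longrightarrow> owns h (own h)"
  unfolding own_def by (rule someI_ex)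

lemma G_E:
  assumes "g \<in> G"
  obtains h where "owns h g" "own h = g"
  using assms owns_own by (auto simp: G_def)

text \<open>A graph edge lies in no hyperedge but its owner, and every owner contributes a single
  pair.\<close>

lemma G_unique:
  assumes "g \<in> G" "g' \<in> G" "h \<in> H" "g \<subseteq> h" "g' \<subseteq> h"
  shows "g = g'"
proof -
  obtain k where k: "owns k g" "own k = g" by (rule G_E[OF assms(1)])
  obtain k' where k': "owns k' g'" "own k' = g'" by (rule G_E[OF assms(2)])
  have "k = h" "k' = h" using k(1) k'(1) assms(3-5) unfolding owns_def by auto
  then show ?thesis using k(2) k'(2) by simp
qed

lemma G_not_B: "g \<in> G \<Longrightarrow> g \<subseteq> h \<Longrightarrow> h \<notin> B"
proof
  assume g: "g \<in> G" and "g \<subseteq> h" "h \<in> B"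
  obtain k where k: "owns k g" by (rule G_E[OF g])
  then have "h = k" using \<open>g \<subseteq> h\<close> \<open>h \<in> B\<close> B_subset unfolding owns_def by blast
  with k \<open>h \<in> B\<close> show False by (auto simp: B_def)
qed

lemma card_H: "card H = card G + card B"
proof -
  let ?A = "{h. \<exists>g. owns h g}"
  have A: "?A \<subseteq> H" by (auto simp: owns_def)
  have "inj_on own ?A"
  proof (rule inj_onI)
    fix h h' assume "h \<in> ?A" "h' \<in> ?A" "own h = own h'"
    then have "owns h (own h)" "owns h' (own h)" using owns_own[of h] owns_own[of h'] by auto
    then show "h = h'" by (auto simp: owns_def)
  qed
  then have "card G = card ?A" unfolding G_def by (rule card_image)
  moreover have "H = ?A \<union> B" "?A \<inter> B = {}" using A by (auto simp: B_def)
  ultimately show ?thesis using card_Un_disjoint[of ?A B] finH finB A finite_subset by metis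
qed

lemma G_pair:
  assumes "{x, y} \<in> G"
  obtains w where "{x, y, w} \<in> H" "x \<noteq> y" "\<And>w'. {x, y, w'} \<in> H \<Longrightarrow> w' = w"
proof -
  obtain h where h: "owns h {x, y}" by (rule G_E[OF assms])
  then have "card {x, y} = 2" unfolding owns_def by blast
  then have ne: "x \<noteq> y" by auto
  have hH: "h \<in> H" "x \<in> h" "y \<in> h" using h unfolding owns_def by blast+
  obtain w where w: "h = {x, y, w}" "w \<noteq> x" "w \<noteq> y" by (rule H_elem_third[OF hH ne])
  show thesis
  proof
    show "{x, y, w} \<in> H" using hH(1) w(1) by simp
    show "w' = w" if w': "{x, y, w'} \<in> H" for w'
    proof -
      have "{x, y, w'} = h" using h w' by (simp add: owns_def)
      then have "w' \<in> {x, y, w}" unfolding w(1) by auto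
      then show ?thesis using H_distinct[OF w'] by auto
    qed
  qed (rule ne)
qed

lemma G_card: "g \<in> G \<Longrightarrow> card g = 2"
  by (erule G_E) (simp add: owns_def)

lemma G_subset: "g \<in> G \<Longrightarrow> g \<subseteq> V"
  using H3 by (elim G_E) (auto simp: owns_def)

lemma finG: "finite G"
proof (rule finite_subset)
  show "G \<subseteq> Pow V" using G_subset by auto
qed (simp add: finV)

lemma N_sym: "w \<in> N v \<longleftrightarrow> v \<in> N w"
  by (simp add: N_def insert_commute)

lemma N_subset: "N v \<subseteq> V"
  using G_subset by (auto simp: N_def)

lemma finN: "finite (N v)" using finite_subset[OF N_subset finV] .

lemma pages_subset: "pages H u v \<subseteq> V"
  using H_in_V by (auto simp: pages_def)

lemma fin_pages: "finite (pages H u v)" using finite_subset[OF pages_subset finV] .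

text \<open>Two graph edges never share a hyperedge, so the third vertices extending \<open>u p\<close> and
  \<open>v p\<close> avoid the spine.\<close>

lemma common_nbrs_le:
  assumes "{u, v, w} \<in> H"
  shows "card (N u \<inter> N v) \<le> C"
proof -
  have ne: "u \<noteq> v" using H_distinct[OF assms] by simp
  have aux: "\<exists>w. w \<noteq> y \<and> {x, p, w} \<in> H" if xp: "{x, p} \<in> G" and "{y, p} \<in> G" "x \<noteq> y" for x y p
  proof -
    obtain w where w: "{x, p, w} \<in> H" by (rule G_pair[OF xp])
    have "w \<noteq> y"
    proof
      assume "w = y"
      then have "{x, p} = {y, p}" using G_unique[OF that(1,2) w] by auto
      then show False using that(3) by (auto simp: doubleton_eq_iff)
    qed
    then show ?thesis using w by blast
  qed
  have "N u \<inter> N v \<subseteq> pages H u v"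
    unfolding pages_def N_def using aux[of u _ v] aux[of v _ u] ne by blast
  then have "card (N u \<inter> N v) \<le> card (pages H u v)" by (rule card_mono[OF fin_pages])
  also have "\<dots> \<le> C" by (rule pages_le[OF assms])
  finally show ?thesis .
qed

lemma G_common_nbrs_le: "{u, v} \<in> G \<Longrightarrow> card (N u \<inter> N v) \<le> C"
  by (erule G_pair) (rule common_nbrs_le)

lemma B_other:
  assumes "h \<in> B" "u \<in> h" "v \<in> h" "u \<noteq> v"
  obtains w where "{u, v, w} \<in> H" "w \<notin> h"
proof -
  have hH: "h \<in> H" using assms(1) B_subset by auto
  have "card {u, v} = 2" using assms(4) by simp
  moreover have "\<not> owns h {u, v}" using assms(1) unfolding B_def by blast
  moreover have "{u, v} \<subseteq> h" using assms(2,3) by simp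
  ultimately have "\<not> (\<forall>h'\<in>H. {u, v} \<subseteq> h' \<longrightarrow> h' = h)"
    using hH unfolding owns_def by blast
  then obtain h' where h': "h' \<in> H" "u \<in> h'" "v \<in> h'" "h' \<noteq> h" by auto
  obtain w where w: "h' = {u, v, w}" by (rule H_elem_third[OF h'(1-3) assms(4)])
  have "w \<notin> h"
  proof
    assume "w \<in> h"
    then have "h' \<subseteq> h" using w assms by auto
    moreover have "finite h" using H3[OF hH] finV finite_subset by blast
    ultimately show False using h'(4) H3[OF hH] H3[OF h'(1)] card_subset_eq[of h h'] by simp
  qed
  then show thesis using that h'(1) w by blast
qed

text \<open>If \<open>{u, v, p}\<close> is in \<open>B\<close>, the pairs \<open>u p\<close> and
  \<open>v p\<close> are not private. Each extends to a second hyperedge, which avoids the remaining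
  spine vertex, so \<open>p\<close> is a page.\<close>

lemma card_B_pair_le:
  assumes "u \<noteq> v"
  shows "card {h \<in> B. u \<in> h \<and> v \<in> h} \<le> C"
proof (cases "\<exists>w. {u, v, w} \<in> H")
  case False
  then have "{h \<in> B. u \<in> h \<and> v \<in> h} = {}"
    using H_elem_third[of _ u v] assms B_subset by blast
  then show ?thesis by (simp only: card.empty)
next
  case True
  then obtain w where w: "{u, v, w} \<in> H" by blast
  have "{h \<in> B. u \<in> h \<and> v \<in> h} \<subseteq> (\<lambda>p. {u, v, p}) ` pages H u v"
  proof
    fix h assume "h \<in> {h \<in> B. u \<in> h \<and> v \<in> h}"
    then have h: "h \<in> B" "u \<in> h" "v \<in> h" "h \<in> H" using B_subset by auto
    obtain p where p: "h = {u, v, p}" "p \<noteq> u" "p \<noteq> v"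
      by (rule H_elem_third[OF h(4,2,3) assms])
    have ph: "p \<in> h" using p by simp
    obtain a where "{u, p, a} \<in> H" "a \<notin> h"
      by (rule B_other[OF h(1,2) ph]) (use p in auto)
    moreover obtain b where "{v, p, b} \<in> H" "b \<notin> h"
      by (rule B_other[OF h(1,3) ph]) (use p in auto)
    moreover have "a \<noteq> v" "b \<noteq> u" using calculation h by auto
    ultimately have "p \<in> pages H u v" unfolding pages_def by blast
    then show "h \<in> (\<lambda>p. {u, v, p}) ` pages H u v" using p by blast
  qed
  then have "card {h \<in> B. u \<in> h \<and> v \<in> h} \<le> card (pages H u v)"
    by (rule surj_card_le[OF fin_pages])
  also have "\<dots> \<le> C" by (rule pages_le[OF w])
  finally show ?thesis .
qed

section \<open>Hyperedges without a private pair as triangles in the graph of pairs of codegree at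
  least two\<close>

definition E2 :: "('a \<times> 'a) set" where
  "E2 = {(u, v). \<exists>w w'. w \<noteq> w' \<and> {u, v, w} \<in> H \<and> {u, v, w'} \<in> H}"

lemma E2_subset: "E2 \<subseteq> V \<times> V"
  using H_in_V by (auto simp: E2_def)

lemma sym_E2: "sym E2"
  by (auto simp: sym_def E2_def insert_commute)

text \<open>Of two extensions of a pair, one avoids any prescribed vertex, so common neighbours in
  \<open>E2\<close> are pages.\<close>

lemma E2_common:
  assumes "(u, v) \<in> E2"
  shows "card {w. (u, w) \<in> E2 \<and> (v, w) \<in> E2} \<le> C"
proof -
  obtain w where w: "{u, v, w} \<in> H" using assms by (auto simp: E2_def)
  have "\<exists>a. a \<noteq> y \<and> {x, p, a} \<in> H" if "(x, p) \<in> E2" for x y p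
    using that unfolding E2_def by clarsimp metis
  then have "{w. (u, w) \<in> E2 \<and> (v, w) \<in> E2} \<subseteq> pages H u v" unfolding pages_def by blast
  then have "card {w. (u, w) \<in> E2 \<and> (v, w) \<in> E2} \<le> card (pages H u v)" by (rule card_mono[OF fin_pages])
  also have "\<dots> \<le> C" by (rule pages_le[OF w])
  finally show ?thesis .
qed

lemma card_B_le_triangles:
  "card B \<le> card {(z, u, v). (z, u) \<in> E2 \<and> (z, v) \<in> E2 \<and> (u, v) \<in> E2}" (is "_ \<le> card ?T")
proof (rule surj_card_le)
  show "finite ?T"
    by (rule finite_subset[of _ "V \<times> V \<times> V"]) (use E2_subset finV in auto)
  have E2: "(x, y) \<in> E2" if h: "h \<in> B" "x \<in> h" "y \<in> h" "x \<noteq> y" for h x y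
  proof -
    have "h \<in> H" using h(1) B_subset by auto
    obtain a where a: "h = {x, y, a}" by (rule H_elem_third[OF \<open>h \<in> H\<close> h(2-4)])
    obtain b where "{x, y, b} \<in> H" "b \<notin> h" by (rule B_other[OF h])
    then show ?thesis using a \<open>h \<in> H\<close> unfolding E2_def by blast
  qed
  show "B \<subseteq> (\<lambda>(x, y, z). {x, y, z}) ` ?T"
  proof
    fix h assume h: "h \<in> B"
    then have "card h = 3" using H3 B_subset by auto
    then obtain x y z where xyz: "h = {x, y, z}" "x \<noteq> y" "x \<noteq> z" "y \<noteq> z"
      by (auto simp: card_3_iff)
    then have "(x, y, z) \<in> ?T" using E2[OF h] by auto
    then show "h \<in> (\<lambda>(x, y, z). {x, y, z}) ` ?T" using xyz(1) by (intro image_eqI) auto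
  qed
qed

section \<open>Degrees in \<open>G\<close>, and the bipartition of the vertices of high
  degree\<close>

lemma sum_deg: "(\<Sum>v\<in>V. deg v) = 2 * card G"
proof -
  have "(\<Sum>v\<in>V. deg v) = card (Sigma V N)" using finV finN by simp
  also have "Sigma V N = (\<Union>g\<in>G. {(x, y). {x, y} = g})"
    using G_subset by (auto simp: N_def)
  also have "card \<dots> = (\<Sum>g\<in>G. card {(x, y). {x, y} = g})"
  proof (rule card_UN_disjoint[OF finG])
    show "\<forall>g\<in>G. finite {(x, y). {x, y} = g}"
    proof
      fix g assume "g \<in> G"
      then have "{(x, y). {x, y} = g} \<subseteq> V \<times> V" using G_subset by auto
      then show "finite {(x, y). {x, y} = g}" by (rule finite_subset) (simp add: finV)
    qed
  qed auto
  also have "\<dots> = (\<Sum>g\<in>G. 2)"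
  proof (rule sum.cong[OF refl])
    fix g assume "g \<in> G"
    then obtain a b where ab: "g = {a, b}" "a \<noteq> b" using G_card by (metis card_2_iff)
    have "{(x, y). {x, y} = g} = {(a, b), (b, a)}" unfolding ab by (auto simp: doubleton_eq_iff)
    then show "card {(x, y). {x, y} = g} = 2" using ab(2) by simp
  qed
  finally show ?thesis by simp
qed

lemma deg_add_le:
  assumes "{u, v} \<in> G"
  shows "deg u + deg v \<le> card V + C"
proof -
  have "deg u + deg v = card (N u \<union> N v) + card (N u \<inter> N v)"
    by (rule card_Un_Int[OF finN finN])
  also have "card (N u \<union> N v) \<le> card V" by (rule card_mono[OF finV]) (use N_subset in auto)
  finally show ?thesis using G_common_nbrs_le[OF assms] by linarith
qed

text \<open>As in the classical proof of Mantel's theorem: summing \<open>deg x + deg y\<close> over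
  ordered edges counts every squared degree twice, and \<open>deg_add_le\<close> bounds each
  term.\<close>

lemma sum_deg_square: "(\<Sum>v\<in>V. deg v * deg v) \<le> card G * (card V + C)"
proof -
  have nb: "N x = {y \<in> V. y \<in> N x}" for x using N_subset by auto
  have sw: "(\<Sum>x\<in>V. \<Sum>y\<in>N x. deg y) = (\<Sum>y\<in>V. \<Sum>x\<in>N y. deg y)"
  proof -
    have "(\<Sum>x\<in>V. \<Sum>y\<in>N x. deg y) = (\<Sum>x\<in>V. \<Sum>y | y \<in> V \<and> y \<in> N x. deg y)" using nb by simp
    also have "\<dots> = (\<Sum>y\<in>V. \<Sum>x | x \<in> V \<and> y \<in> N x. deg y)" by (rule sum.swap_restrict[OF finV finV])
    also have "\<dots> = (\<Sum>y\<in>V. \<Sum>x\<in>N y. deg y)"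
    proof (rule sum.cong[OF refl])
      fix y
      have "{x. x \<in> V \<and> y \<in> N x} = N y" using N_subset[of y] N_sym by blast
      then show "(\<Sum>x | x \<in> V \<and> y \<in> N x. deg y) = (\<Sum>x\<in>N y. deg y)" by simp
    qed
    finally show ?thesis .
  qed
  have "2 * (\<Sum>v\<in>V. deg v * deg v) = (\<Sum>x\<in>V. \<Sum>y\<in>N x. deg x + deg y)"
    unfolding sum.distrib sw by simp
  also have "\<dots> \<le> (\<Sum>x\<in>V. \<Sum>y\<in>N x. card V + C)"
    by (intro sum_mono deg_add_le) (simp add: N_def)
  also have "\<dots> = (\<Sum>v\<in>V. deg v) * (card V + C)" by (simp add: sum_distrib_right)
  finally show ?thesis by (simp add: sum_deg)
qed

definition low :: "'a set" where
  "low = {v \<in> V. real (deg v) \<le> 9 / 20 * n}"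

lemma fin_low: "finite low" using finV by (simp add: low_def)

text \<open>Chebyshev's inequality around the ideal degree \<open>n / 2\<close>: each vertex of
  \<open>low\<close> deviates by at least \<open>n / 20\<close>, and \<open>sum_deg_square\<close>
  bounds the total squared deviation.\<close>

lemma card_low:
  "real (card low) * (n / 20)\<^sup>2 \<le> n * (n\<^sup>2 / 4 - card G) + C * real (card G)"
proof -
  have "real (card low) * (n / 20)\<^sup>2 = (\<Sum>v\<in>low. (n / 20)\<^sup>2)" by simp
  also have "\<dots> \<le> (\<Sum>v\<in>low. (n / 2 - deg v)\<^sup>2)"
    by (intro sum_mono power_mono) (auto simp: low_def)
  also have "\<dots> \<le> (\<Sum>v\<in>V. (n / 2 - deg v)\<^sup>2)"
    by (rule sum_mono2) (use finV in \<open>auto simp: low_def\<close>)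
  also have "\<dots> = (\<Sum>v\<in>V. n\<^sup>2 / 4 - n * deg v + real (deg v * deg v))"
    by (intro sum.cong) (auto simp: power2_eq_square field_simps)
  also have "\<dots> = n * (n\<^sup>2 / 4) - n * (2 * card G) + real (\<Sum>v\<in>V. deg v * deg v)"
    unfolding sum.distrib sum_subtractf sum_distrib_left[symmetric]
    using arg_cong[OF sum_deg, of real] by simp
  also have "real (\<Sum>v\<in>V. deg v * deg v) \<le> real (card G * (card V + C))"
    using sum_deg_square of_nat_le_iff by blast
  finally show ?thesis by (simp add: algebra_simps)
qed

text \<open>The neighbourhoods \<open>U\<close> and \<open>W\<close> of an edge with ends of high
  degree are almost disjoint and leave little uncovered. Every vertex outside \<open>low\<close> has
  at least \<open>3 / 10 * n\<close> neighbours in one of them, and this decides its side. Two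
  vertices on the same side then have more than \<open>C\<close> common neighbours, which
  \<open>common_nbrs_le\<close> forbids for vertices of one hyperedge.\<close>

lemma bipartition:
  assumes e: "{u0, v0} \<in> G" "u0 \<notin> low" "v0 \<notin> low"
    and small: "1000 * real (card low) \<le> n" and C: "1000 * real C \<le> n"
  shows "\<exists>X Y. X \<union> Y = V - low \<and> X \<inter> Y = {} \<and>
     (\<forall>x\<in>X. \<forall>y\<in>X. \<forall>w. {x, y, w} \<notin> H) \<and> (\<forall>x\<in>Y. \<forall>y\<in>Y. \<forall>w. {x, y, w} \<notin> H)"
proof -
  define U where "U = N u0"
  define W where "W = N v0"
  have UV: "u0 \<in> V" "v0 \<in> V" using G_subset[OF e(1)] by auto
  have high: "9 / 20 * n < deg v" if "v \<in> V" "v \<notin> low" for v using that by (auto simp: low_def)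
  have U: "9 / 20 * n < card U" "9 / 20 * n < card W"
    using high UV e by (auto simp: U_def W_def)
  have sumUW: "real (card U) + real (card W) \<le> n + C"
    using deg_add_le[OF e(1)] by (simp add: U_def W_def)
  have n0: "0 < n" using UV finV by (auto simp: card_gt_0_iff)
  have fin: "finite U" "finite W" using finN by (auto simp: U_def W_def)
  have cap: "real (card (N u \<inter> N v)) \<le> C" if "{u, v} \<in> G" for u v
    using G_common_nbrs_le[OF that] by simp
  \<comment> \<open>\<open>N p\<close> is almost disjoint from \<open>U\<close> and from
    \<open>N w\<close>, since \<open>p\<close> is adjacent to \<open>u0\<close> and to
    \<open>w\<close>. Both lie, up to \<open>2 * C\<close> vertices, in the rest of size at most
    \<open>11 / 20 * n\<close>, which forces an overlap of about \<open>7 / 20 * n\<close>.\<close>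
  have large: "3 / 10 * n \<le> card (N w \<inter> U)"
    if w: "w \<in> V" "w \<notin> low" and p: "p \<in> N w" "p \<in> U" "p \<notin> low" for w p
  proof -
    have pV: "p \<in> V" using p(1) N_subset by auto
    have "{p, u0} \<in> G" "{p, w} \<in> G" using p by (auto simp: N_def U_def insert_commute)
    then have c: "real (card (N p \<inter> U)) \<le> C" "real (card (N p \<inter> N w)) \<le> C"
      using cap by (auto simp: U_def)
    have "N p \<union> (U \<union> N w) \<subseteq> V" using N_subset by (auto simp: U_def)
    then have "card (N p \<union> (U \<union> N w)) \<le> card V" by (rule card_mono[OF finV])
    moreover have "deg p + card (U \<union> N w) = card (N p \<union> (U \<union> N w)) + card (N p \<inter> (U \<union> N w))"
      by (rule card_Un_Int) (use fin finN in auto)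
    moreover have "card (N p \<inter> (U \<union> N w)) \<le> card (N p \<inter> U) + card (N p \<inter> N w)"
      unfolding Int_Un_distrib by (rule card_Un_le)
    ultimately have "real (deg p) + real (card (U \<union> N w)) \<le> n + 2 * C" using c by linarith
    moreover have "card U + deg w = card (U \<union> N w) + card (U \<inter> N w)"
      by (rule card_Un_Int) (use fin finN in auto)
    ultimately show ?thesis using high[OF pV p(3)] high[OF w] U C n0
      by (simp add: Int_commute)
  qed
  define X where "X = {w \<in> V - low. N w \<inter> U \<subseteq> low}"
  define Y where "Y = {w \<in> V - low. \<not> N w \<inter> U \<subseteq> low}"
  have Ylarge: "3 / 10 * n \<le> card (N y \<inter> U)" if "y \<in> Y" for y
    using that large[of y] by (auto simp: Y_def)
  \<comment> \<open>Apart from \<open>low\<close>, the neighbours of \<open>x\<close> avoid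
    \<open>U\<close>, and little of \<open>V\<close> lies outside both \<open>U\<close> and
    \<open>W\<close>.\<close>
  have Xlarge: "3 / 10 * n \<le> card (N x \<inter> W)" if "x \<in> X" for x
  proof -
    have "card (U \<union> W) + card (U \<inter> W) = card U + card W"
      by (rule card_Un_Int[symmetric]) (use fin in auto)
    moreover have "real (card (U \<inter> W)) \<le> C" using cap[OF e(1)] by (simp add: U_def W_def)
    moreover have "card (V - (U \<union> W)) = card V - card (U \<union> W)" "card (U \<union> W) \<le> card V"
      using N_subset finV fin by (auto simp: U_def W_def intro!: card_Diff_subset card_mono)
    ultimately have rest: "real (card (V - (U \<union> W))) \<le> n / 10 + C" using U by simp
    have "N x \<subseteq> low \<union> (N x \<inter> W) \<union> (V - (U \<union> W))" using that N_subset by (auto simp: X_def)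
    then have "deg x \<le> card (low \<union> (N x \<inter> W) \<union> (V - (U \<union> W)))"
      by (rule card_mono[rotated]) (use fin_low fin finV in auto)
    also have "\<dots> \<le> card low + card (N x \<inter> W) + card (V - (U \<union> W))"
      by (intro order_trans[OF card_Un_le] add_mono card_Un_le order_refl)
    finally have "real (deg x) \<le> card low + card (N x \<inter> W) + card (V - (U \<union> W))" by linarith
    moreover have "9 / 20 * n < deg x" using high that by (auto simp: X_def)
    ultimately show ?thesis using rest small C by simp
  qed
  \<comment> \<open>Since \<open>U\<close> and \<open>W\<close> have total size at most
    \<open>n + C\<close> and each exceeds \<open>9 / 20 * n\<close>, each is below
    \<open>58 / 100 * n\<close>. Two subsets of size \<open>3 / 10 * n\<close> then share more than
    \<open>C\<close> vertices.\<close>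
  have no: "{x, y, w} \<notin> H"
    if Z: "finite Z" "real (card Z) \<le> 58 / 100 * n" "3 / 10 * n \<le> card (N x \<inter> Z)" "3 / 10 * n \<le> card (N y \<inter> Z)"
    for x y w Z
  proof
    assume h: "{x, y, w} \<in> H"
    have "card (N x \<inter> Z) + card (N y \<inter> Z) = card (N x \<inter> Z \<union> N y \<inter> Z) + card (N x \<inter> Z \<inter> (N y \<inter> Z))"
      by (rule card_Un_Int) (use Z in auto)
    also have "\<dots> \<le> card Z + card (N x \<inter> N y)"
      by (intro add_mono card_mono) (use Z finN in auto)
    also have "\<dots> \<le> card Z + C" using common_nbrs_le[OF h] by simp
    finally have "real (card (N x \<inter> Z)) + real (card (N y \<inter> Z)) \<le> card Z + C" by linarith
    then show False using Z(2-4) C n0 by simp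
  qed
  show ?thesis
  proof (rule exI[of _ X], rule exI[of _ Y], intro conjI ballI allI)
    show "X \<union> Y = V - low" "X \<inter> Y = {}" by (auto simp: X_def Y_def)
    show "{x, y, w} \<notin> H" if "x \<in> X" "y \<in> X" for x y w
      by (rule no[of W]) (use fin Xlarge that sumUW U C in auto)
    show "{x, y, w} \<notin> H" if "x \<in> Y" "y \<in> Y" for x y w
      by (rule no[of U]) (use fin Ylarge that sumUW U C in auto)
  qed
qed

end

section \<open>Counting around the vertices of low degree\<close>

context sparse_triples begin

definition nbrs :: "'a set \<Rightarrow> 'a \<Rightarrow> 'a set" where
  "nbrs Z r = {x \<in> Z. \<exists>w. {r, x, w} \<in> H}"

definition miss :: "'a set \<Rightarrow> 'a set \<Rightarrow> ('a \<times> 'a) set" where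
  "miss X Y = {(x, y). x \<in> X \<and> y \<in> Y \<and> {x, y} \<notin> G}"

text \<open>For a pair of neighbours of \<open>r\<close> that is not bad, \<open>r\<close> is the
  unique vertex completing the graph edge \<open>{x, y}\<close>.\<close>

definition bad :: "'a set \<Rightarrow> 'a set \<Rightarrow> 'a \<Rightarrow> ('a \<times> 'a) set" where
  "bad X Y r = {(x, y). x \<in> nbrs X r \<and> y \<in> nbrs Y r \<and> \<not> ({x, y} \<in> G \<and> {x, y, r} \<in> H)}"

text \<open>These hyperedges cannot be charged injectively to missing pairs, because another vertex
  completes the same pair.\<close>

definition shared :: "'a set \<Rightarrow> 'a set \<Rightarrow> 'a \<Rightarrow> 'a \<Rightarrow> 'a set set" where
  "shared X Y r r' = {h \<in> B. \<exists>x\<in>X. \<exists>y\<in>Y. h = {x, y, r} \<and> {x, y, r'} \<in> H}"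

end

text \<open>Later \<open>R\<close> is \<open>low\<close>, and \<open>X\<close> and \<open>Y\<close>
  come from \<open>bipartition\<close>.\<close>

locale split_triples = sparse_triples +
  fixes R X Y :: "'a set"
  assumes cover: "R \<union> X \<union> Y = V"
    and disj: "R \<inter> X = {}" "R \<inter> Y = {}" "X \<inter> Y = {}"
    and noX: "\<And>x y w. x \<in> X \<Longrightarrow> y \<in> X \<Longrightarrow> {x, y, w} \<notin> H"
    and noY: "\<And>x y w. x \<in> Y \<Longrightarrow> y \<in> Y \<Longrightarrow> {x, y, w} \<notin> H"
begin

lemma swap: "split_triples V H C R Y X"
  by unfold_locales (use cover disj noX noY in auto)

text \<open>The error term: a bound on the bad pairs of any single vertex, later a small fraction of
  the squared order.\<close>

definition defect :: nat where
  "defect = card (miss X Y) + C * card V"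

lemma fins: "finite R" "finite X" "finite Y"
  using cover finV by (auto intro: finite_subset)

lemma fin_nbrs: "finite (nbrs X r)" "finite (nbrs Y r)"
  using fins by (auto simp: nbrs_def)

lemma fin_miss: "finite (miss X Y)"
  by (rule finite_subset[of _ "X \<times> Y"]) (use fins in \<open>auto simp: miss_def\<close>)

lemma card_miss_swap: "card (miss Y X) = card (miss X Y)"
proof -
  have "miss Y X = prod.swap ` miss X Y"
    by (auto simp: miss_def insert_commute image_iff)
  then show ?thesis by (simp add: card_image)
qed

lemma defect_swap: "split_triples.defect V H C Y X = defect"
  by (simp add: split_triples.defect_def[OF swap] defect_def card_miss_swap)

text \<open>If \<open>{x, y}\<close> is a graph edge completed by some \<open>w\<close> other than
  \<open>r\<close>, then \<open>y\<close> is a page of the spine \<open>r x\<close>: use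
  \<open>w\<close> on the side of \<open>x\<close>, and on the side of \<open>r\<close> any
  hyperedge containing \<open>r\<close> and \<open>y\<close>. So every \<open>x\<close> has at most
  \<open>C\<close> bad partners besides the missing ones.\<close>

lemma card_bad: "card (bad X Y r) \<le> defect"
proof -
  have "bad X Y r \<subseteq> miss X Y \<union> (SIGMA x : nbrs X r. pages H r x)"
  proof (rule subrelI)
    fix x y assume b: "(x, y) \<in> bad X Y r"
    show "(x, y) \<in> miss X Y \<union> (SIGMA x : nbrs X r. pages H r x)"
    proof (cases "{x, y} \<in> G")
      case False
      then show ?thesis using b by (auto simp: bad_def miss_def nbrs_def)
    next
      case True
      then have r: "{x, y, r} \<notin> H" using b by (auto simp: bad_def)
      obtain w where w: "{x, y, w} \<in> H" by (rule G_pair[OF True])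
      obtain w' where w': "{r, y, w'} \<in> H" using b by (auto simp: bad_def nbrs_def)
      have "w \<noteq> r" using w r by auto
      moreover have "w' \<noteq> x"
      proof
        assume "w' = x"
        moreover have "{r, y, x} = {x, y, r}" by auto
        ultimately show False using w' r by simp
      qed
      ultimately have "y \<in> pages H r x" unfolding pages_def using w w' by blast
      then show ?thesis using b by (auto simp: bad_def)
    qed
  qed
  then have "card (bad X Y r) \<le> card (miss X Y \<union> (SIGMA x : nbrs X r. pages H r x))"
    by (rule card_mono[rotated]) (simp add: fin_miss fin_nbrs fin_pages)
  also have "\<dots> \<le> card (miss X Y) + card (SIGMA x : nbrs X r. pages H r x)" by (rule card_Un_le)
  also have "card (SIGMA x : nbrs X r. pages H r x) = (\<Sum>x\<in>nbrs X r. card (pages H r x))"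
    by (simp add: fin_nbrs fin_pages)
  also have "\<dots> \<le> (\<Sum>x\<in>nbrs X r. C)"
  proof (rule sum_mono)
    fix x assume "x \<in> nbrs X r"
    then obtain w where "{r, x, w} \<in> H" by (auto simp: nbrs_def)
    then show "card (pages H r x) \<le> C" by (rule pages_le)
  qed
  also have "\<dots> \<le> C * card V"
  proof -
    have "card (nbrs X r) \<le> card V" by (rule card_mono[OF finV]) (use cover in \<open>auto simp: nbrs_def\<close>)
    then show ?thesis by simp
  qed
  finally show ?thesis by (simp add: defect_def)
qed

lemma fin_bad: "finite (bad X Y r)"
  by (rule finite_subset[of _ "nbrs X r \<times> nbrs Y r"]) (auto simp: bad_def fin_nbrs)

text \<open>A graph edge \<open>r y\<close> shares its hyperedge with no other graph edge, so all pairs \<open>x y\<close>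
  with \<open>x\<close> a neighbour of \<open>r\<close> are bad.\<close>

lemma nbrs_deg_le:
  assumes "r \<in> R"
  shows "card (nbrs X r) * card (N r \<inter> Y) \<le> defect"
proof -
  have "nbrs X r \<times> (N r \<inter> Y) \<subseteq> bad X Y r"
  proof (rule subrelI)
    fix x y assume xy: "(x, y) \<in> nbrs X r \<times> (N r \<inter> Y)"
    then have ry: "{r, y} \<in> G" by (simp add: N_def)
    then obtain w where "{r, y, w} \<in> H" by (rule G_pair)
    moreover have False if "{x, y} \<in> G" "{x, y, r} \<in> H"
    proof -
      have "{x, y} = {r, y}" by (rule G_unique[OF that(1) ry that(2)]) auto
      then have "x = r" by (auto simp: doubleton_eq_iff)
      then show False using xy assms disj by (auto simp: nbrs_def)
    qed
    ultimately show "(x, y) \<in> bad X Y r" using xy unfolding bad_def nbrs_def by blast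
  qed
  then have "card (nbrs X r \<times> (N r \<inter> Y)) \<le> card (bad X Y r)" by (rule card_mono[OF fin_bad])
  then show ?thesis using card_bad[of r] by (simp add: card_cartesian_product)
qed

text \<open>A graph edge is completed by one vertex only, so every pair of common neighbours is bad
  for \<open>r\<close> or for \<open>r'\<close>.\<close>

lemma common_nbrs_two:
  assumes "r \<noteq> r'"
  shows "card (nbrs X r \<inter> nbrs X r') * card (nbrs Y r \<inter> nbrs Y r') \<le> 2 * defect"
proof -
  have "(nbrs X r \<inter> nbrs X r') \<times> (nbrs Y r \<inter> nbrs Y r') \<subseteq> bad X Y r \<union> bad X Y r'"
  proof (rule subrelI)
    fix x y assume xy: "(x, y) \<in> (nbrs X r \<inter> nbrs X r') \<times> (nbrs Y r \<inter> nbrs Y r')"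
    have "\<not> ({x, y} \<in> G \<and> {x, y, r} \<in> H \<and> {x, y, r'} \<in> H)"
      using assms by (metis G_pair)
    then show "(x, y) \<in> bad X Y r \<union> bad X Y r'" using xy by (auto simp: bad_def)
  qed
  then have "card ((nbrs X r \<inter> nbrs X r') \<times> (nbrs Y r \<inter> nbrs Y r')) \<le> card (bad X Y r \<union> bad X Y r')"
    by (rule card_mono[rotated]) (simp add: fin_bad)
  also have "\<dots> \<le> card (bad X Y r) + card (bad X Y r')" by (rule card_Un_le)
  finally show ?thesis using card_bad[of r] card_bad[of r'] by (simp add: card_cartesian_product)
qed

text \<open>Three vertices distributed over \<open>X\<close> and \<open>Y\<close> would put two on
  the same side.\<close>

lemma H_meets_R:
  assumes h: "h \<in> H"
  shows "\<exists>r\<in>R. \<exists>a b. h = {r, a, b} \<and> (a \<in> R \<or> b \<in> R \<or> a \<in> X \<and> b \<in> Y)"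
proof -
  have "card h = 3" using H3[OF h] by simp
  then obtain a b c where abc: "h = {a, b, c}" by (auto simp: card_3_iff)
  have V: "a \<in> R \<union> X \<union> Y" "b \<in> R \<union> X \<union> Y" "c \<in> R \<union> X \<union> Y"
    using H3[OF h] abc cover by auto
  have perm: "{a, b, c} = {b, a, c}" "{a, b, c} = {c, a, b}" "{a, b, c} = {a, c, b}"
     "{a, b, c} = {b, c, a}" "{a, b, c} = {c, b, a}" by auto
  have ex: "\<not> (a \<in> X \<and> b \<in> X)" "\<not> (a \<in> X \<and> c \<in> X)" "\<not> (b \<in> X \<and> c \<in> X)"
    "\<not> (a \<in> Y \<and> b \<in> Y)" "\<not> (a \<in> Y \<and> c \<in> Y)" "\<not> (b \<in> Y \<and> c \<in> Y)"
    using noX noY h perm abc by metis+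
  consider "a \<in> R" | "b \<in> R" | "c \<in> R" using V ex by blast
  then show ?thesis
  proof cases
    case 1
    then show ?thesis using V ex abc perm(3) by (intro bexI[OF _ 1]) blast
  next
    case 2
    then show ?thesis using V ex abc perm(1,4) by (intro bexI[OF _ 2]) blast
  next
    case 3
    then show ?thesis using V ex abc perm(2,5) by (intro bexI[OF _ 3]) blast
  qed
qed

text \<open>A hyperedge of \<open>B\<close> at \<open>r\<close> contains a neighbour of
  \<open>r\<close> in \<open>X\<close> or a further vertex of \<open>R\<close>, and
  \<open>card_B_pair_le\<close> bounds the hyperedges for each of these. By \<open>swap\<close> the
  bound holds with \<open>Y\<close> too, so one small side suffices.\<close>

lemma card_B_at:
  assumes r: "r \<in> R"
  shows "card {h \<in> B. r \<in> h} \<le> C * (card (nbrs X r) + card R)"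
proof -
  let ?W = "nbrs X r \<union> (R - {r})"
  have "{h \<in> B. r \<in> h} \<subseteq> (\<Union>w\<in>?W. {h \<in> B. r \<in> h \<and> w \<in> h})"
  proof
    fix h assume "h \<in> {h \<in> B. r \<in> h}"
    then have h: "h \<in> B" "r \<in> h" "h \<in> H" using B_subset by auto
    obtain s a b where s: "s \<in> R" "h = {s, a, b}" "a \<in> R \<or> b \<in> R \<or> a \<in> X \<and> b \<in> Y"
      using H_meets_R[OF h(3)] by blast
    have d: "s \<noteq> a" "s \<noteq> b" "a \<noteq> b" using H_distinct h(3) s(2) by blast+
    have "\<exists>w\<in>?W. w \<in> h"
    proof (cases "r = s")
      case True
      then show ?thesis using s d h(3) by (auto simp: nbrs_def)
    next
      case False
      then show ?thesis using s by auto
    qed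
    then show "h \<in> (\<Union>w\<in>?W. {h \<in> B. r \<in> h \<and> w \<in> h})" using h by blast
  qed
  then have "card {h \<in> B. r \<in> h} \<le> card (\<Union>w\<in>?W. {h \<in> B. r \<in> h \<and> w \<in> h})"
    by (rule card_mono[rotated]) (simp add: fin_nbrs fins finB)
  also have "\<dots> \<le> (\<Sum>w\<in>?W. card {h \<in> B. r \<in> h \<and> w \<in> h})"
    by (rule card_UN_le) (simp add: fin_nbrs fins)
  also have "\<dots> \<le> (\<Sum>w\<in>?W. C)"
    by (intro sum_mono card_B_pair_le) (use r disj in \<open>auto simp: nbrs_def\<close>)
  also have "\<dots> = C * card ?W" by simp
  also have "card ?W \<le> card (nbrs X r) + card (R - {r})" by (rule card_Un_le)
  also have "card (R - {r}) \<le> card R" by (rule card_mono) (use fins in auto)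
  finally show ?thesis by simp
qed

lemma card_shared:
  assumes r: "r \<in> R"
  shows "card (shared X Y r r') \<le> C * card (nbrs X r \<inter> nbrs X r')"
proof -
  let ?W = "nbrs X r \<inter> nbrs X r'"
  have p: "{x, y, s} = {s, x, y}" for x y s :: 'a by auto
  have "shared X Y r r' \<subseteq> (\<Union>x\<in>?W. {h \<in> B. r \<in> h \<and> x \<in> h})"
  proof
    fix h assume "h \<in> shared X Y r r'"
    then obtain x y where h: "h \<in> B" "x \<in> X" "h = {x, y, r}" "{x, y, r'} \<in> H"
      by (auto simp: shared_def)
    have "{r, x, y} \<in> H" "{r', x, y} \<in> H" using h(1,3,4) B_subset p by auto
    then have "x \<in> ?W" using h(2) by (auto simp: nbrs_def)
    then show "h \<in> (\<Union>x\<in>?W. {h \<in> B. r \<in> h \<and> x \<in> h})" using h by blast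
  qed
  then have "card (shared X Y r r') \<le> card (\<Union>x\<in>?W. {h \<in> B. r \<in> h \<and> x \<in> h})"
    by (rule card_mono[rotated]) (simp add: fin_nbrs finB)
  also have "\<dots> \<le> (\<Sum>x\<in>?W. card {h \<in> B. r \<in> h \<and> x \<in> h})"
    by (rule card_UN_le) (simp add: fin_nbrs)
  also have "\<dots> \<le> (\<Sum>x\<in>?W. C)"
    by (intro sum_mono card_B_pair_le) (use r disj in \<open>auto simp: nbrs_def\<close>)
  finally show ?thesis by (simp add: mult.commute)
qed

lemma shared_swap: "shared Y X r r' = shared X Y r r'"
proof -
  have "h = {y, x, r} \<and> {y, x, r'} \<in> H \<longleftrightarrow> h = {x, y, r} \<and> {x, y, r'} \<in> H" for h x y
    by (simp add: insert_commute[of y x])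
  then show ?thesis unfolding shared_def by blast
qed

lemma card_G_le:
  "card G + card (miss X Y) \<le> card X * card Y + (\<Sum>r\<in>R. deg r)"
proof -
  let ?P = "{(x, y). x \<in> X \<and> y \<in> Y \<and> {x, y} \<in> G}"
  have finP: "finite ?P" by (rule finite_subset[of _ "X \<times> Y"]) (use fins in auto)
  have "G \<subseteq> (\<lambda>(x, y). {x, y}) ` ?P \<union> (\<Union>r\<in>R. (\<lambda>w. {r, w}) ` N r)"
  proof
    fix g assume g: "g \<in> G"
    then obtain a b where ab: "g = {a, b}" using G_card by (metis card_2_iff)
    obtain w where w: "{a, b, w} \<in> H" by (rule G_pair[OF g[unfolded ab]])
    have V: "a \<in> R \<union> X \<union> Y" "b \<in> R \<union> X \<union> Y" using H_in_V[OF w] cover by auto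
    have p: "{a, b} = {b, a}" by auto
    show "g \<in> (\<lambda>(x, y). {x, y}) ` ?P \<union> (\<Union>r\<in>R. (\<lambda>w. {r, w}) ` N r)"
    proof (cases "a \<in> R \<or> b \<in> R")
      case True
      moreover have "b \<in> N a" using g ab by (simp add: N_def)
      ultimately have "g \<in> (\<Union>r\<in>R. (\<lambda>w. {r, w}) ` N r)"
        using N_sym[of b a] ab p by blast
      then show ?thesis ..
    next
      case False
      then have "a \<in> X \<and> b \<in> Y \<or> a \<in> Y \<and> b \<in> X" using V noX[of a b w] noY[of a b w] w by blast
      then have "g \<in> (\<lambda>(x, y). {x, y}) ` ?P"
      proof
        assume "a \<in> X \<and> b \<in> Y"
        then show ?thesis using g ab by (intro image_eqI[of _ _ "(a, b)"]) auto
      next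
        assume "a \<in> Y \<and> b \<in> X"
        then show ?thesis using g ab p by (intro image_eqI[of _ _ "(b, a)"]) auto
      qed
      then show ?thesis ..
    qed
  qed
  then have "card G \<le> card ((\<lambda>(x, y). {x, y}) ` ?P \<union> (\<Union>r\<in>R. (\<lambda>w. {r, w}) ` N r))"
    by (rule card_mono[rotated]) (use finP fins finN in auto)
  also have "\<dots> \<le> card ((\<lambda>(x, y). {x, y}) ` ?P) + card (\<Union>r\<in>R. (\<lambda>w. {r, w}) ` N r)"
    by (rule card_Un_le)
  also have "card ((\<lambda>(x, y). {x, y}) ` ?P) \<le> card ?P" by (rule card_image_le[OF finP])
  also have "card (\<Union>r\<in>R. (\<lambda>w. {r, w}) ` N r) \<le> (\<Sum>r\<in>R. card ((\<lambda>w. {r, w}) ` N r))"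
    by (rule card_UN_le[OF fins(1)])
  also have "\<dots> \<le> (\<Sum>r\<in>R. deg r)" by (intro sum_mono card_image_le finN)
  finally have "card G \<le> card ?P + (\<Sum>r\<in>R. deg r)" by simp
  moreover have "card ?P + card (miss X Y) = card (?P \<union> miss X Y)"
    by (rule card_Un_disjoint[symmetric]) (use finP fin_miss in \<open>auto simp: miss_def\<close>)
  moreover have "?P \<union> miss X Y = X \<times> Y" by (auto simp: miss_def)
  ultimately show ?thesis by (simp add: card_cartesian_product)
qed

text \<open>The pairs good for different vertices are disjoint, since a graph edge has only one
  completion, and each vertex of \<open>Z\<close> has at least \<open>\<alpha>^2 - defect\<close> of
  them.\<close>

lemma card_hubs:
  assumes "Z \<subseteq> R" and "0 \<le> \<alpha>"
    and "\<And>r. r \<in> Z \<Longrightarrow> \<alpha> \<le> real (card (nbrs X r)) \<and> \<alpha> \<le> real (card (nbrs Y r))"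
  shows "real (card Z) * (\<alpha>\<^sup>2 - defect) \<le> n\<^sup>2"
proof -
  let ?O = "\<lambda>r. nbrs X r \<times> nbrs Y r - bad X Y r"
  have finZ: "finite Z" using assms(1) fins finite_subset by blast
  have "real (card Z) * (\<alpha>\<^sup>2 - defect) = (\<Sum>r\<in>Z. \<alpha>\<^sup>2 - defect)" by simp
  also have "\<dots> \<le> (\<Sum>r\<in>Z. real (card (?O r)))"
  proof (rule sum_mono)
    fix r assume r: "r \<in> Z"
    have "\<alpha>\<^sup>2 \<le> real (card (nbrs X r)) * real (card (nbrs Y r))"
      unfolding power2_eq_square using assms(2) assms(3)[OF r] by (intro mult_mono) auto
    also have "\<dots> = real (card (nbrs X r \<times> nbrs Y r))" by (simp add: card_cartesian_product)
    also have "card (nbrs X r \<times> nbrs Y r) \<le> card (?O r) + card (bad X Y r)"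
      using diff_card_le_card_Diff[OF fin_bad[of r], of "nbrs X r \<times> nbrs Y r"] by linarith
    finally show "\<alpha>\<^sup>2 - defect \<le> card (?O r)" using card_bad[of r] by linarith
  qed
  also have "\<dots> = real (\<Sum>r\<in>Z. card (?O r))" by simp
  also have "(\<Sum>r\<in>Z. card (?O r)) = card (\<Union>r\<in>Z. ?O r)"
  proof (rule card_UN_disjoint[symmetric, OF finZ])
    show "\<forall>r\<in>Z. finite (?O r)" using fin_nbrs by auto
    show "\<forall>r\<in>Z. \<forall>r'\<in>Z. r \<noteq> r' \<longrightarrow> ?O r \<inter> ?O r' = {}"
    proof (intro ballI impI)
      fix r r' :: 'a assume "r \<noteq> r'"
      have "\<not> ({x, y} \<in> G \<and> {x, y, r} \<in> H \<and> {x, y, r'} \<in> H)" for x y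
        using \<open>r \<noteq> r'\<close> by (metis G_pair)
      then show "?O r \<inter> ?O r' = {}" by (auto simp: bad_def)
    qed
  qed
  also have "card (\<Union>r\<in>Z. ?O r) \<le> card (V \<times> V)"
    by (rule card_mono) (use finV cover in \<open>auto simp: nbrs_def\<close>)
  finally show ?thesis by (simp add: card_cartesian_product power2_eq_square)
qed

text \<open>Hyperedges \<open>x y r\<close> of \<open>B\<close> for which \<open>r\<close> is the only vertex of \<open>Z\<close> extending \<open>x y\<close>
  are paid for by the missing pair \<open>x y\<close>.\<close>

lemma card_B_le:
  assumes Z: "Z \<subseteq> R"
  shows "card B \<le> (\<Sum>r\<in>R - Z. card {h \<in> B. r \<in> h}) + C * (card Z)\<^sup>2 +
    (\<Sum>r\<in>Z. \<Sum>r'\<in>Z - {r}. card (shared X Y r r')) + card (miss X Y)"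
proof -
  define B0 where "B0 = (\<Union>r\<in>R - Z. {h \<in> B. r \<in> h})"
  define B1 where "B1 = (\<Union>(r, r')\<in>{(r, r'). r \<in> Z \<and> r' \<in> Z \<and> r \<noteq> r'}. {h \<in> B. r \<in> h \<and> r' \<in> h})"
  define B2 where "B2 = (\<Union>r\<in>Z. \<Union>r'\<in>Z - {r}. shared X Y r r')"
  \<comment> \<open>For the hyperedges left over, the completing vertex in \<open>Z\<close> is
    unique, so \<open>SOME\<close> recovers it and the missing pair determines the
    hyperedge.\<close>
  define B3 where "B3 = (\<lambda>(x, y). {x, y, SOME r. r \<in> Z \<and> {x, y, r} \<in> H}) ` miss X Y"
  have finZ: "finite Z" using Z fins finite_subset by blast
  have "B \<subseteq> B0 \<union> B1 \<union> B2 \<union> B3"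
  proof
    fix h assume h: "h \<in> B"
    then have hH: "h \<in> H" using B_subset by auto
    obtain r a b where r: "r \<in> R" "h = {r, a, b}" "a \<in> R \<or> b \<in> R \<or> a \<in> X \<and> b \<in> Y"
      using H_meets_R[OF hH] by blast
    have d: "r \<noteq> a" "r \<noteq> b" "a \<noteq> b" using H_distinct hH r(2) by blast+
    show "h \<in> B0 \<union> B1 \<union> B2 \<union> B3"
    proof (cases "\<exists>s\<in>R - Z. s \<in> h")
      case True
      then show ?thesis using h unfolding B0_def by blast
    next
      case out: False
      then have rZ: "r \<in> Z" using r by auto
      show ?thesis
      proof (cases "a \<in> R \<or> b \<in> R")
        case True
        then obtain s where s: "s \<in> h" "s \<in> R" "s \<noteq> r" using r d by auto
        then have "s \<in> Z" using out by auto
        then have "h \<in> B1" unfolding B1_def using rZ s h r(2) by auto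
        then show ?thesis by simp
      next
        case False
        then have ab: "a \<in> X" "b \<in> Y" using r by auto
        have h': "h = {a, b, r}" using r(2) by auto
        show ?thesis
        proof (cases "\<exists>r'\<in>Z - {r}. {a, b, r'} \<in> H")
          case True
          then have "h \<in> B2" unfolding B2_def shared_def using rZ h h' ab by blast
          then show ?thesis by simp
        next
          case False
          have "(SOME s. s \<in> Z \<and> {a, b, s} \<in> H) = r"
            by (rule some_equality) (use rZ hH h' False in auto)
          moreover have "(a, b) \<in> miss X Y"
            unfolding miss_def using ab h h' G_not_B[of "{a, b}" h] by auto
          ultimately have "h \<in> B3" unfolding B3_def h' by (intro image_eqI[of _ _ "(a, b)"]) auto
          then show ?thesis by simp
        qed
      qed
    qed
  qed
  moreover have fin: "finite B0" "finite B1" "finite B2" "finite B3"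
  proof -
    show "finite B0" "finite B1" using finB by (auto intro: finite_subset[of _ B] simp: B0_def B1_def)
    show "finite B2" using finB by (auto intro: finite_subset[of _ B] simp: B2_def shared_def)
    show "finite B3" using fin_miss by (simp add: B3_def)
  qed
  ultimately have "card B \<le> card (B0 \<union> B1 \<union> B2 \<union> B3)" by (intro card_mono) auto
  also have "\<dots> \<le> card B0 + card B1 + card B2 + card B3"
    by (intro order_trans[OF card_Un_le] add_mono order_refl)
  also have "card B0 \<le> (\<Sum>r\<in>R - Z. card {h \<in> B. r \<in> h})"
    unfolding B0_def by (rule card_UN_le) (use fins in auto)
  also have "card B1 \<le> C * (card Z)\<^sup>2"
  proof -
    let ?P = "{(r, r'). r \<in> Z \<and> r' \<in> Z \<and> r \<noteq> r'}"
    have P: "?P \<subseteq> Z \<times> Z" by auto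
    then have finP: "finite ?P" by (rule finite_subset) (use finZ in auto)
    have "card B1 \<le> (\<Sum>p\<in>?P. card (case p of (r, r') \<Rightarrow> {h \<in> B. r \<in> h \<and> r' \<in> h}))"
      unfolding B1_def by (rule card_UN_le[OF finP])
    also have "\<dots> \<le> (\<Sum>p\<in>?P. C)"
      by (rule sum_mono) (auto intro!: card_B_pair_le)
    also have "\<dots> = C * card ?P" by simp
    also have "card ?P \<le> card (Z \<times> Z)" by (rule card_mono[OF _ P]) (use finZ in auto)
    finally show ?thesis by (simp add: card_cartesian_product power2_eq_square)
  qed
  also have "card B2 \<le> (\<Sum>r\<in>Z. \<Sum>r'\<in>Z - {r}. card (shared X Y r r'))"
    unfolding B2_def
    by (rule order_trans[OF card_UN_le[OF finZ]], rule sum_mono, rule card_UN_le) (use finZ in auto)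
  also have "card B3 \<le> card (miss X Y)"
    unfolding B3_def by (rule card_image_le[OF fin_miss])
  finally show ?thesis by simp
qed

end

section \<open>The budget argument: \<open>R\<close> is a single hub\<close>

context split_triples begin

text \<open>A pair that is not missing lies in a hyperedge, whose third vertex must be in
  \<open>R\<close>.\<close>

lemma card_XY_le:
  "card X * card Y \<le> card (miss X Y) + (\<Sum>r\<in>R. card (nbrs X r) * card (nbrs Y r))"
proof -
  let ?U = "\<Union>r\<in>R. nbrs X r \<times> nbrs Y r"
  have p: "{x, y, w} = {w, x, y}" "{x, y, w} = {w, y, x}" for x y w :: 'a by auto
  have "X \<times> Y \<subseteq> miss X Y \<union> ?U"
  proof (rule subrelI)
    fix x y assume "(x, y) \<in> X \<times> Y"
    then have xy: "x \<in> X" "y \<in> Y" by auto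
    show "(x, y) \<in> miss X Y \<union> ?U"
    proof (cases "{x, y} \<in> G")
      case False
      then show ?thesis using xy by (simp add: miss_def)
    next
      case True
      then obtain w where w: "{x, y, w} \<in> H" by (rule G_pair)
      have "w \<notin> X" using noX[OF xy(1), of w y] w by (auto simp: insert_commute)
      moreover have "w \<notin> Y" using noY[OF xy(2), of w x] w by (auto simp: insert_commute)
      ultimately have "w \<in> R" using H_in_V[OF w] cover by auto
      moreover have "{w, x, y} \<in> H" "{w, y, x} \<in> H" using w p by metis+
      ultimately show ?thesis using xy unfolding nbrs_def by blast
    qed
  qed
  then have "card (X \<times> Y) \<le> card (miss X Y \<union> ?U)"
    by (rule card_mono[rotated]) (use fin_miss fins fin_nbrs in auto)
  also have "\<dots> \<le> card (miss X Y) + card ?U" by (rule card_Un_le)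
  also have "card ?U \<le> (\<Sum>r\<in>R. card (nbrs X r \<times> nbrs Y r))" by (rule card_UN_le[OF fins(1)])
  finally show ?thesis by (simp add: card_cartesian_product)
qed

lemma card_parts: "card X + card Y + card R = card V"
proof -
  have "card (R \<union> X \<union> Y) = card R + card X + card Y"
    using fins disj by (subst card_Un_disjoint; (subst card_Un_disjoint)?) auto
  then show ?thesis using cover by simp
qed

lemma card_XY_le_square: "real (card X) * real (card Y) \<le> (n - card R)\<^sup>2 / 4"
proof -
  have "n - card R = real (card X) + real (card Y)" using card_parts by linarith
  moreover have "0 \<le> (real (card X) - real (card Y))\<^sup>2" by simp
  ultimately show ?thesis by (simp add: power2_eq_square algebra_simps)
qed

text \<open>Here \<open>\<eta>\<close> is the hub threshold, \<open>\<rho>\<close> bounds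
  \<open>R\<close>, \<open>\<sigma>\<close> bounds the overlap of two hubs and \<open>\<mu>\<close>
  the defect. Each vertex of \<open>R\<close> lowers the bound on \<open>card X * card Y\<close> by
  about \<open>n / 2\<close>. A hub returns almost nothing, any other vertex a little less than
  \<open>n / 2\<close>, and the total loss may be only about \<open>n / 2\<close>. So there is at
  most one hub; with none, too few pairs would be completed; and one hub exhausts the
  budget.\<close>

lemma card_R_eq_1:
  fixes \<eta> \<rho> \<sigma> \<mu> :: real
  assumes C: "1 \<le> C"
    and lowdeg: "\<And>r. r \<in> R \<Longrightarrow> real (deg r) \<le> 9 / 20 * n"
    and eta: "0 < \<eta>" "200 * C * \<eta> \<le> 1"
    and rho: "0 \<le> \<rho>" "real (card R) \<le> \<rho> * n" "200 * C * \<rho> \<le> 1" "\<rho> \<le> 1 / 1000"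
    and mu: "defect \<le> \<mu> * n\<^sup>2" "2 * \<mu> \<le> \<sigma>\<^sup>2" "2 * \<mu> + \<rho> * \<eta> \<le> \<eta>\<^sup>2"
    and sigma: "0 < \<sigma>" "2000 * C * (\<sigma> * n + 1) \<le> \<eta>\<^sup>2 * n"
    and n: "100 \<le> n"
    and cardH: "n\<^sup>2 / 4 - n / 2 - 1 / 2 \<le> card H" and cardG: "n\<^sup>2 / 5 \<le> card G"
  shows "card R = 1"
proof -
  define Z where "Z = {r \<in> R. \<eta> * n \<le> card (nbrs X r) \<and> \<eta> * n \<le> card (nbrs Y r)}"
  have Z: "Z \<subseteq> R" by (auto simp: Z_def)
  have finZ: "finite Z" using Z fins finite_subset by blast
  define h where "h = real (card Z)"
  define s where "s = real (card (R - Z))"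
  have hs: "real (card R) = h + s"
    using card_Diff_subset[OF finZ Z] card_mono[OF fins(1) Z] by (simp add: h_def s_def of_nat_diff)
  have h0: "0 \<le> h" "0 \<le> s" by (auto simp: h_def s_def)
  have n0: "0 < n" using n by linarith
  have Crho: "C * \<rho> \<le> 1 / 200" and Ceta: "C * \<eta> \<le> 1 / 200" using rho eta by auto
  have "1 * \<eta> \<le> C * \<eta>" by (rule mult_right_mono) (use C eta in auto)
  then have eta200: "\<eta> \<le> 1 / 200" using Ceta by linarith

  \<comment> \<open>The number of hubs is bounded in terms of \<open>\<eta>\<close> alone,
    independently of \<open>n\<close>.\<close>
  have h_le: "h * \<eta>\<^sup>2 \<le> 2"
  proof -
    have "\<mu> * n\<^sup>2 \<le> \<eta>\<^sup>2 / 2 * n\<^sup>2"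
    proof (rule mult_right_mono)
      have "0 \<le> \<rho> * \<eta>" using rho(1) eta(1) by simp
      then show "\<mu> \<le> \<eta>\<^sup>2 / 2" using mu(3) by linarith
    qed simp
    then have "\<eta>\<^sup>2 / 2 * n\<^sup>2 \<le> (\<eta> * n)\<^sup>2 - defect"
      using mu(1) by (simp add: power_mult_distrib)
    then have "h * (\<eta>\<^sup>2 / 2 * n\<^sup>2) \<le> h * ((\<eta> * n)\<^sup>2 - defect)" using h0(1) by (rule mult_left_mono)
    also have "\<dots> \<le> n\<^sup>2"
      unfolding h_def by (rule card_hubs[OF Z]) (use eta n0 in \<open>auto simp: Z_def\<close>)
    finally have "(h * \<eta>\<^sup>2 / 2) * n\<^sup>2 \<le> 1 * n\<^sup>2" by (simp add: mult_ac)
    then have "h * \<eta>\<^sup>2 / 2 \<le> 1" using n0 by (simp only: mult_le_cancel_right_pos[OF zero_less_power[OF n0]])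
    then show ?thesis by simp
  qed

  \<comment> \<open>A hub has many neighbours on both sides, so \<open>nbrs_deg_le\<close> and its
    mirror image leave it few graph edges to either side; those into \<open>R\<close> are few
    because \<open>R\<close> is small.\<close>
  have deg_Z: "real (deg r) \<le> \<eta> * n" if r: "r \<in> Z" for r
  proof -
    have rR: "r \<in> R" using r Z by auto
    have part: "real k * \<eta> \<le> \<mu> * n" if "m * k \<le> defect" "\<eta> * n \<le> real m" for m k :: nat
    proof -
      have "(real k * \<eta>) * n \<le> real k * real m" using that(2) by (simp add: mult_left_mono mult.assoc)
      also have "\<dots> \<le> defect" using that(1) by (metis mult.commute of_nat_le_iff of_nat_mult)
      also have "\<dots> \<le> (\<mu> * n) * n" using mu(1) by (simp add: power2_eq_square mult.assoc)
      finally show ?thesis using n0 by simp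
    qed
    have 1: "real (card (N r \<inter> Y)) * \<eta> \<le> \<mu> * n"
      by (rule part[OF nbrs_deg_le[OF rR]]) (use r in \<open>simp add: Z_def\<close>)
    have 2: "real (card (N r \<inter> X)) * \<eta> \<le> \<mu> * n"
      by (rule part[OF split_triples.nbrs_deg_le[OF swap rR, unfolded defect_swap]])
        (use r in \<open>simp add: Z_def\<close>)
    have "deg r \<le> card ((N r \<inter> Y) \<union> (N r \<inter> X) \<union> (N r \<inter> R))"
      by (rule card_mono) (use finN N_subset cover in auto)
    also have "\<dots> \<le> card (N r \<inter> Y) + card (N r \<inter> X) + card (N r \<inter> R)"
      by (intro order_trans[OF card_Un_le] add_mono card_Un_le order_refl)
    finally have "deg r \<le> card (N r \<inter> Y) + card (N r \<inter> X) + card (N r \<inter> R)" .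
    moreover have "card (N r \<inter> R) \<le> card R" by (rule card_mono) (use fins in auto)
    ultimately have "real (deg r) \<le> card (N r \<inter> Y) + card (N r \<inter> X) + \<rho> * n" using rho(2) by linarith
    then have "real (deg r) * \<eta> \<le> (card (N r \<inter> Y) + card (N r \<inter> X) + \<rho> * n) * \<eta>"
      using eta(1) by (intro mult_right_mono) auto
    also have "\<dots> \<le> (2 * \<mu> + \<rho> * \<eta>) * n" using 1 2 by (simp add: algebra_simps)
    also have "\<dots> \<le> \<eta>\<^sup>2 * n" using mu(3) by (intro mult_right_mono) auto
    finally have "real (deg r) * \<eta> \<le> (\<eta> * n) * \<eta>" by (simp add: power2_eq_square mult_ac)
    then show ?thesis using eta(1) by (simp only: mult_le_cancel_right_pos)
  qed
  have sum_deg_R: "real (\<Sum>r\<in>R. deg r) \<le> h * (\<eta> * n) + s * (9 / 20 * n)"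
  proof -
    have "(\<Sum>r\<in>R. deg r) = (\<Sum>r\<in>R - Z. deg r) + (\<Sum>r\<in>Z. deg r)"
      by (rule sum.subset_diff[OF Z fins(1)])
    then have "real (\<Sum>r\<in>R. deg r) = (\<Sum>r\<in>R - Z. real (deg r)) + (\<Sum>r\<in>Z. real (deg r))" by simp
    also have "\<dots> \<le> (\<Sum>r\<in>R - Z. 9 / 20 * n) + (\<Sum>r\<in>Z. \<eta> * n)"
      by (intro add_mono sum_mono lowdeg deg_Z) auto
    finally show ?thesis by (simp add: h_def s_def)
  qed

  have B_at: "real (card {h \<in> B. r \<in> h}) \<le> n / 100" if r: "r \<in> R - Z" for r
  proof -
    have part: "real b \<le> n / 100" if "b \<le> C * (m + card R)" "real m < \<eta> * n" for b m :: nat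
    proof -
      have "real b \<le> real (C * (m + card R))" using that(1) of_nat_le_iff by blast
      also have "\<dots> = C * (real m + real (card R))" by simp
      also have "\<dots> \<le> C * (\<eta> * n + \<rho> * n)" using that(2) rho(2) by (intro mult_left_mono) auto
      also have "\<dots> = (C * \<eta> + C * \<rho>) * n" by (simp add: algebra_simps)
      also have "\<dots> \<le> (1 / 100) * n" using Crho Ceta by (intro mult_right_mono) auto
      finally show ?thesis by simp
    qed
    have rR: "r \<in> R" using r by auto
    have "card (nbrs X r) < \<eta> * n \<or> card (nbrs Y r) < \<eta> * n" using r by (auto simp: Z_def)
    then show ?thesis
      using part[OF card_B_at[OF rR]] part[OF split_triples.card_B_at[OF swap rR]] by blast
  qed
  have sum_B: "real (\<Sum>r\<in>R - Z. card {h \<in> B. r \<in> h}) \<le> s * (n / 100)"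
  proof -
    have "real (\<Sum>r\<in>R - Z. card {h \<in> B. r \<in> h}) \<le> (\<Sum>r\<in>R - Z. n / 100)"
      unfolding of_nat_sum by (intro sum_mono B_at)
    then show ?thesis by (simp add: s_def)
  qed

  \<comment> \<open>The product of the two overlaps is at most twice the defect, hence at most
    \<open>(\<sigma> * n)^2\<close>, so one of them is at most \<open>\<sigma> * n\<close>.\<close>
  have shared_le: "real (card (shared X Y r r')) \<le> C * (\<sigma> * n)" if r: "r \<in> Z" "r' \<in> Z - {r}" for r r'
  proof -
    let ?a = "card (nbrs X r \<inter> nbrs X r')" and ?b = "card (nbrs Y r \<inter> nbrs Y r')"
    have rR: "r \<in> R" using r Z by auto
    have "real ?a \<le> \<sigma> * n \<or> real ?b \<le> \<sigma> * n"
    proof (rule ccontr)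
      assume "\<not> ?thesis"
      then have gt: "\<sigma> * n < real ?a" "\<sigma> * n < real ?b" by auto
      have P0: "0 < \<sigma> * n" using sigma(1) n0 by simp
      have "(\<sigma> * n) * (\<sigma> * n) < real ?a * real ?b"
        by (rule mult_strict_mono[OF gt]) (use gt P0 in linarith)+
      also have "\<dots> \<le> real (2 * defect)"
        unfolding of_nat_mult[symmetric] of_nat_le_iff by (rule common_nbrs_two) (use r in auto)
      also have "\<dots> \<le> (2 * \<mu>) * n\<^sup>2" using mu(1) by simp
      also have "\<dots> \<le> \<sigma>\<^sup>2 * n\<^sup>2" using mu(2) by (intro mult_right_mono) auto
      finally show False by (simp add: power2_eq_square mult_ac)
    qed
    moreover have "real c \<le> C * (\<sigma> * n)" if "c \<le> C * m" "real m \<le> \<sigma> * n" for c m :: nat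
    proof -
      have "real c \<le> real C * real m" using that(1) by (metis of_nat_le_iff of_nat_mult)
      also have "\<dots> \<le> C * (\<sigma> * n)" using that(2) by (intro mult_left_mono) auto
      finally show ?thesis .
    qed
    ultimately show ?thesis
      using card_shared[OF rR, of r'] split_triples.card_shared[OF swap rR, of r']
      unfolding shared_swap by blast
  qed
  have sum_shared: "real (C * (card Z)\<^sup>2 + (\<Sum>r\<in>Z. \<Sum>r'\<in>Z - {r}. card (shared X Y r r'))) \<le> h * (n / 1000)"
  proof -
    have "real (\<Sum>r\<in>Z. \<Sum>r'\<in>Z - {r}. card (shared X Y r r')) \<le> (\<Sum>r\<in>Z. \<Sum>r'\<in>Z - {r}. C * (\<sigma> * n))"
      unfolding of_nat_sum by (intro sum_mono shared_le)
    also have "\<dots> \<le> (\<Sum>r\<in>Z. \<Sum>r'\<in>Z. C * (\<sigma> * n))"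
      by (intro sum_mono sum_mono2) (use finZ sigma n0 in auto)
    also have "\<dots> = h * (h * (C * (\<sigma> * n)))" by (simp add: h_def)
    finally have "real (C * (card Z)\<^sup>2 + (\<Sum>r\<in>Z. \<Sum>r'\<in>Z - {r}. card (shared X Y r r')))
        \<le> h * (h * (C * (\<sigma> * n + 1)))"
      by (simp add: h_def power2_eq_square algebra_simps)
    also have "\<dots> \<le> h * (n / 1000)"
    proof (rule mult_left_mono[OF _ h0(1)])
      have "h * (2000 * C * (\<sigma> * n + 1)) \<le> h * (\<eta>\<^sup>2 * n)" using sigma(2) h0(1) by (rule mult_left_mono)
      also have "\<dots> \<le> 2 * n" using mult_right_mono[OF h_le, of n] by (simp add: mult.assoc)
      finally show "h * (C * (\<sigma> * n + 1)) \<le> n / 1000" by simp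
    qed
    finally show ?thesis .
  qed

  \<comment> \<open>The missing pairs cancel: they are subtracted in \<open>card_G_le\<close> and
    paid back in \<open>card_B_le\<close>.\<close>
  have total: "real (card H) \<le> real (card X) * real (card Y) + h * (\<eta> * n) + s * (9 / 20 * n) + s * (n / 100) + h * (n / 1000)"
  proof -
    have "real (card G) + card (miss X Y) \<le> real (card X) * real (card Y) + real (\<Sum>r\<in>R. deg r)"
      using card_G_le by (metis of_nat_add of_nat_le_iff of_nat_mult)
    moreover have "real (card B) \<le> real (\<Sum>r\<in>R - Z. card {h \<in> B. r \<in> h}) +
        real (C * (card Z)\<^sup>2 + (\<Sum>r\<in>Z. \<Sum>r'\<in>Z - {r}. card (shared X Y r r'))) + card (miss X Y)"
      using card_B_le[OF Z] by linarith
    ultimately show ?thesis using sum_deg_R sum_B sum_shared card_H by linarith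
  qed
  \<comment> \<open>Both coefficients start from \<open>1 / 2 - 1 / 4000\<close>, the second term
    absorbing the square of \<open>card R\<close>. A hub subtracts
    \<open>1 / 200 + 1 / 1000\<close>, any other vertex \<open>9 / 20 + 1 / 100\<close>. The right
    side is \<open>(n + 1) / 2\<close> divided by \<open>n\<close>, for \<open>n\<close> at least
    100.\<close>
  have key: "h * (49375 / 100000) + s * (3975 / 100000) \<le> 505 / 1000"
  proof -
    have "real (card R) * real (card R) \<le> real (card R) * (n / 1000)"
      using rho(2) mult_right_mono[OF rho(4), of n] by (intro mult_left_mono) auto
    then have "(h + s) * (h + s) \<le> (h + s) * (n / 1000)" unfolding hs .
    moreover have "(n - k)\<^sup>2 / 4 = n\<^sup>2 / 4 - k * n / 2 + k * k / 4" for k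
      by (simp add: power2_eq_square field_simps)
    ultimately have "(n - (h + s))\<^sup>2 / 4 \<le> n\<^sup>2 / 4 - (h + s) * n / 2 + (h + s) * (n / 4000)"
      by simp
    moreover have "h * (\<eta> * n) \<le> h * (n / 200)"
      using eta200 h0 n0 mult_right_mono[of \<eta> "1 / 200" n] by (intro mult_left_mono) auto
    ultimately have "n\<^sup>2 / 4 - n / 2 - 1 / 2 \<le> n\<^sup>2 / 4 - (h + s) * n / 2 + (h + s) * (n / 4000)
        + h * (n / 200) + s * (9 / 20 * n) + s * (n / 100) + h * (n / 1000)"
      using total card_XY_le_square cardH unfolding hs by linarith
    then have "(h * (49375 / 100000) + s * (3975 / 100000)) * n \<le> (n + 1) / 2"
      by (simp add: algebra_simps)
    also have "\<dots> \<le> 505 / 1000 * n" using n by simp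
    finally show ?thesis using n0 by simp
  qed
  \<comment> \<open>Without hubs \<open>R\<close> has at most 13 vertices, each completing at most
    \<open>\<eta> * n^2\<close> pairs between \<open>X\<close> and \<open>Y\<close>. This is too few
    for the edges of \<open>G\<close>.\<close>
  have "h \<noteq> 0"
  proof
    assume "h = 0"
    then have "Z = {}" using finZ by (simp add: h_def)
    have s12: "s \<le> 13" using key \<open>h = 0\<close> by simp
    have "real (\<Sum>r\<in>R. card (nbrs X r) * card (nbrs Y r)) \<le> (\<Sum>r\<in>R. \<eta> * n * n)"
      unfolding of_nat_sum of_nat_mult
    proof (rule sum_mono)
      fix r assume "r \<in> R"
      moreover have "r \<notin> Z" using \<open>Z = {}\<close> by simp
      ultimately have few: "card (nbrs X r) \<le> \<eta> * n \<or> card (nbrs Y r) \<le> \<eta> * n" unfolding Z_def by auto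
      have "nbrs X r \<subseteq> V" "nbrs Y r \<subseteq> V" using cover by (auto simp: nbrs_def)
      then have "card (nbrs X r) \<le> card V" "card (nbrs Y r) \<le> card V"
        using card_mono[OF finV] by auto
      then have le: "real (card (nbrs X r)) \<le> n" "real (card (nbrs Y r)) \<le> n" by simp_all
      from few show "real (card (nbrs X r)) * real (card (nbrs Y r)) \<le> \<eta> * n * n"
      proof
        assume "card (nbrs X r) \<le> \<eta> * n"
        then show ?thesis by (rule mult_mono) (use le eta n0 in auto)
      next
        assume "card (nbrs Y r) \<le> \<eta> * n"
        then have "real (card (nbrs X r)) * real (card (nbrs Y r)) \<le> n * (\<eta> * n)"
          by (rule mult_mono[OF le(1)]) auto
        then show ?thesis by (simp only: mult_ac)
      qed
    qed
    also have "\<dots> = s * (\<eta> * n\<^sup>2)" using hs \<open>h = 0\<close> by (simp add: power2_eq_square mult.assoc)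
    also have "\<dots> \<le> 13 * (1 / 200 * n\<^sup>2)"
      using s12 eta200 eta(1) h0 by (intro mult_mono mult_right_mono) auto
    finally have S: "real (\<Sum>r\<in>R. card (nbrs X r) * card (nbrs Y r)) \<le> 13 / 200 * n\<^sup>2" by simp
    have "real (\<Sum>r\<in>R. deg r) \<le> s * (9 / 20 * n)" using sum_deg_R \<open>h = 0\<close> by simp
    also have "\<dots> \<le> 13 * (9 / 20 * n)" using s12 n0 by (intro mult_right_mono) auto
    finally have D: "real (\<Sum>r\<in>R. deg r) \<le> 6 * n" using n0 by simp
    have "card G \<le> (\<Sum>r\<in>R. card (nbrs X r) * card (nbrs Y r)) + (\<Sum>r\<in>R. deg r)"
      using card_G_le card_XY_le by linarith
    then have "n\<^sup>2 / 5 \<le> 13 / 200 * n\<^sup>2 + 6 * n" using S D cardG by linarith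
    moreover have "100 * n \<le> n\<^sup>2" using mult_right_mono[OF n, of n] by (simp add: power2_eq_square)
    ultimately show False using n0 by linarith
  qed
  then have "card Z \<ge> 1" by (simp add: h_def)
  moreover have "card Z < 2"
  proof (rule ccontr)
    assume "\<not> card Z < 2"
    then have "2 \<le> h" by (simp add: h_def)
    then show False using key h0 by simp
  qed
  ultimately have "h = 1" by (simp add: h_def)
  moreover have "card (R - Z) < 1"
  proof (rule ccontr)
    assume "\<not> card (R - Z) < 1"
    then have "1 \<le> s" by (simp add: s_def)
    then show False using key \<open>h = 1\<close> by simp
  qed
  ultimately show ?thesis using hs by (simp add: s_def)
qed

end

section \<open>The extremal hypergraph\<close>

lemma four_mult_le_square: "4 * (a * b) \<le> (a + b)\<^sup>2" for a b :: nat
proof -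
  have "real (4 * (a * b)) \<le> real ((a + b)\<^sup>2)"
    using zero_le_power2[of "real a - real b"] by (simp add: power2_eq_square algebra_simps)
  then show ?thesis by (simp only: of_nat_le_iff)
qed

context sparse_triples begin

lemma ex_edge_outside:
  assumes "card low * card V < card G"
  obtains u v where "{u, v} \<in> G" "u \<notin> low" "v \<notin> low"
proof -
  have "\<exists>g\<in>G. g \<inter> low = {}"
  proof (rule ccontr)
    assume no: "\<not> ?thesis"
    have "G \<subseteq> (\<lambda>(r, w). {r, w}) ` (low \<times> V)"
    proof
      fix g assume g: "g \<in> G"
      then obtain r where r: "r \<in> g" "r \<in> low" using no by blast
      obtain a b where "g = {a, b}" using G_card[OF g] by (metis card_2_iff)
      then obtain w where w: "g = {r, w}" using r(1) by auto
      then have "w \<in> V" using G_subset[OF g] by auto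
      then show "g \<in> (\<lambda>(r, w). {r, w}) ` (low \<times> V)" using w r(2) by auto
    qed
    then have "card G \<le> card (low \<times> V)" by (rule surj_card_le[rotated]) (use fin_low finV in auto)
    then show False using assms by (simp add: card_cartesian_product)
  qed
  then obtain g where g: "g \<in> G" "g \<inter> low = {}" by blast
  obtain a b where "g = {a, b}" using G_card[OF g(1)] by (metis card_2_iff)
  then show thesis using that g by auto
qed

lemma card_G_le_square: "real (card G) \<le> n\<^sup>2"
proof -
  have "2 * card G = (\<Sum>v\<in>V. deg v)" by (rule sum_deg[symmetric])
  also have "\<dots> \<le> (\<Sum>v\<in>V. card V)" by (intro sum_mono card_mono finV N_subset)
  finally have "card G \<le> card V * card V" by simp
  then show ?thesis unfolding power2_eq_square by (metis of_nat_le_iff of_nat_mult)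
qed

text \<open>The constants are chosen in the order \<open>\<eta>\<close>, \<open>\<sigma>\<close>,
  \<open>\<rho>\<close>, \<open>\<delta>\<close>, each small compared with the previous one. Once
  \<open>low\<close> is a single vertex \<open>z\<close>, every hyperedge is \<open>z\<close> with a
  pair between \<open>X\<close> and \<open>Y\<close>, and the size of \<open>H\<close> leaves no
  slack.\<close>

lemma star_structure:
  fixes \<delta> :: real
  assumes C: "1 \<le> C"
    and eta: "\<eta> = 1 / (200 * real C)" and sigma: "\<sigma> = \<eta>\<^sup>2 / (4000 * real C)"
    and rho: "\<rho> = \<sigma>\<^sup>2 / 8" and delta: "\<delta> = \<rho> / 800"
    and n: "100 \<le> n" "C \<le> \<delta> * n" "4000 * C \<le> \<eta>\<^sup>2 * n" "2 \<le> \<delta> * n"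
    and B: "card B \<le> \<delta> / 2 * n\<^sup>2"
    and cardH: "(card V - 1)\<^sup>2 div 4 \<le> card H"
  shows "\<exists>z X Y. z \<notin> X \<and> z \<notin> Y \<and> X \<inter> Y = {} \<and> {z} \<union> X \<union> Y = V \<and>
    H = (\<lambda>(x, y). {x, y, z}) ` (X \<times> Y) \<and> card X * card Y = (card V - 1)\<^sup>2 div 4"
proof -
  have n0: "0 < n" using n by linarith
  have C1: "1 \<le> real C" using C by simp
  have eta0: "0 < \<eta>" and eta_C: "200 * C * \<eta> = 1" using C1 by (simp_all add: eta)
  have eta1: "\<eta> \<le> 1 / 200" using C1 by (simp add: eta field_simps)
  have sigma0: "0 < \<sigma>" using eta0 C1 by (simp add: sigma)
  have sigma_C: "C * \<sigma> = \<eta>\<^sup>2 / 4000" using C1 by (simp add: sigma)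
  have "1 * \<sigma> \<le> C * \<sigma>" using C1 sigma0 by (intro mult_right_mono) auto
  then have sigma_eta: "\<sigma> \<le> \<eta>\<^sup>2 / 4000" using sigma_C by simp
  have eta_sq: "\<eta>\<^sup>2 \<le> \<eta> * (1 / 200)" unfolding power2_eq_square using eta0 eta1 by (intro mult_left_mono) auto
  have sigma_le: "\<sigma> \<le> \<eta> / 4" "\<sigma> \<le> 1 / 4000" using sigma_eta eta_sq eta1 eta0 by linarith+
  have rho0: "0 < \<rho>" using sigma0 by (simp add: rho)
  have sigma_sq: "\<sigma>\<^sup>2 \<le> \<sigma>" unfolding power2_eq_square using sigma0 sigma_le by (simp add: mult_le_cancel_left1)
  have rho_sigma: "\<rho> \<le> \<sigma>" using sigma_sq sigma0 by (simp add: rho)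
  have delta0: "0 < \<delta>" using rho0 by (simp add: delta)

  \<comment> \<open>One half of \<open>\<delta> * n^2\<close> absorbs the linear loss in
    \<open>lower\<close>, the other half absorbs \<open>card B\<close>.\<close>
  have nn: "n \<le> \<delta> / 2 * n\<^sup>2"
    using mult_right_mono[OF n(4), of n] n0 by (simp add: power2_eq_square mult.assoc)
  have lower: "n\<^sup>2 / 4 - n / 2 - 1 / 2 \<le> card H"
  proof -
    \<comment> \<open>Rounding down loses at most 3 after multiplication by 4, which gives the
      constant \<open>1 / 2\<close> in \<open>lower\<close>.\<close>
    have "(card V - 1)\<^sup>2 \<le> 4 * ((card V - 1)\<^sup>2 div 4) + 3" by presburger
    then have "(card V - 1)\<^sup>2 \<le> 4 * card H + 3" using cardH by linarith
    then have "real ((card V - 1)\<^sup>2) \<le> real (4 * card H + 3)" by (simp only: of_nat_le_iff)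
    moreover have "real (card V - 1) = n - 1" using n0 by (simp add: of_nat_diff)
    ultimately have "(n - 1)\<^sup>2 \<le> 4 * real (card H) + 3" by simp
    then show ?thesis by (simp add: power2_eq_square algebra_simps)
  qed
  have G_lower: "n\<^sup>2 / 4 - \<delta> * n\<^sup>2 \<le> card G"
    using lower card_H B nn n by simp
  have delta_le: "\<delta> \<le> 1 / 100" using rho_sigma sigma_le by (simp add: delta)
  have G5: "n\<^sup>2 / 5 \<le> card G"
    using G_lower mult_right_mono[OF delta_le, of "n\<^sup>2"] by simp

  have low: "real (card low) \<le> \<rho> * n"
  proof -
    have "real (card low) * (n / 20)\<^sup>2 \<le> n * (n\<^sup>2 / 4 - card G) + C * real (card G)"
      by (rule card_low)
    also have "\<dots> \<le> n * (\<delta> * n\<^sup>2) + (\<delta> * n) * n\<^sup>2"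
      using G_lower n(2) card_G_le_square n0 by (intro add_mono mult_mono mult_left_mono) auto
    \<comment> \<open>The factor 800 in \<open>\<delta>\<close> is \<open>2 * 20^2\<close>: two
      error terms against the squared deviation \<open>(n / 20)^2\<close>.\<close>
    also have "\<dots> = (\<rho> * n) * (n / 20)\<^sup>2" by (simp add: delta power2_eq_square)
    finally show ?thesis using n0 by (simp only: mult_le_cancel_right_pos[OF zero_less_power] divide_pos_pos)
  qed
  have low_n: "1000 * real (card low) \<le> n"
  proof -
    have "\<rho> * n \<le> 1 / 1000 * n" by (rule mult_right_mono) (use rho_sigma sigma_le n0 in linarith)+
    then show ?thesis using low by simp
  qed
  have Cn: "1000 * real C \<le> n"
  proof -
    have "\<delta> \<le> 1 / 1000" using rho_sigma sigma_le by (simp add: delta)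
    then have "\<delta> * n \<le> 1 / 1000 * n" by (rule mult_right_mono) (use n0 in simp)
    then show ?thesis using n(2) by simp
  qed
  have "real (card low * card V) < real (card G)"
  proof -
    have "real (card low * card V) \<le> n / 1000 * n"
      using low_n n0 unfolding of_nat_mult by (intro mult_right_mono) auto
    also have "\<dots> < n\<^sup>2 / 5" using n0 by (simp add: power2_eq_square)
    finally show ?thesis using G5 by linarith
  qed
  then have "card low * card V < card G" by (simp only: of_nat_less_iff)
  then obtain u0 v0 where uv: "{u0, v0} \<in> G" "u0 \<notin> low" "v0 \<notin> low" by (rule ex_edge_outside)
  obtain X Y where XY: "X \<union> Y = V - low" "X \<inter> Y = {}"
    and noX: "\<forall>x\<in>X. \<forall>y\<in>X. \<forall>w. {x, y, w} \<notin> H" and noY: "\<forall>x\<in>Y. \<forall>y\<in>Y. \<forall>w. {x, y, w} \<notin> H"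
    using bipartition[OF uv low_n Cn] by (elim exE conjE)
  interpret split_triples V H C low X Y
  proof unfold_locales
    show "low \<union> X \<union> Y = V" "low \<inter> X = {}" "low \<inter> Y = {}" using XY by (auto simp: low_def)
    show "X \<inter> Y = {}" by (rule XY(2))
    show "{x, y, w} \<notin> H" if "x \<in> X" "y \<in> X" for x y w using noX that by blast
    show "{x, y, w} \<notin> H" if "x \<in> Y" "y \<in> Y" for x y w using noY that by blast
  qed

  have deg_sum: "real (\<Sum>r\<in>low. deg r) \<le> \<rho> * n\<^sup>2"
  proof -
    have "(\<Sum>r\<in>low. deg r) \<le> (\<Sum>r\<in>low. card V)" by (intro sum_mono card_mono finV N_subset)
    then have "(\<Sum>r\<in>low. deg r) \<le> card low * card V" by simp
    then have "real (\<Sum>r\<in>low. deg r) \<le> real (card low) * n"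
      unfolding of_nat_mult[symmetric] of_nat_le_iff .
    also have "\<dots> \<le> \<rho> * n * n" using low n0 by (intro mult_right_mono) auto
    finally show ?thesis by (simp add: power2_eq_square mult.assoc)
  qed
  have defect: "defect \<le> \<sigma>\<^sup>2 / 2 * n\<^sup>2"
  proof -
    have "(n - card low)\<^sup>2 \<le> n\<^sup>2" using low_n n0 by (intro power_mono) auto
    then have "real (card X) * real (card Y) \<le> n\<^sup>2 / 4" using card_XY_le_square by simp
    moreover have "real (card G) + card (miss X Y) \<le> real (card X) * real (card Y) + real (\<Sum>r\<in>low. deg r)"
      using card_G_le by (metis of_nat_add of_nat_le_iff of_nat_mult)
    ultimately have "card (miss X Y) \<le> (\<delta> + \<rho>) * n\<^sup>2"
      using G_lower deg_sum by (simp add: algebra_simps)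
    moreover have "C * n \<le> \<delta> * n\<^sup>2"
      using mult_right_mono[OF n(2), of n] n0 by (simp add: power2_eq_square mult.assoc)
    ultimately have "real defect \<le> (2 * \<delta> + \<rho>) * n\<^sup>2" by (simp add: defect_def algebra_simps)
    also have "\<dots> \<le> \<sigma>\<^sup>2 / 2 * n\<^sup>2"
      using sigma0 by (intro mult_right_mono) (auto simp: delta rho)
    finally show ?thesis .
  qed

  have "card low = 1"
  proof (rule card_R_eq_1[where \<eta> = \<eta> and \<sigma> = \<sigma> and \<rho> = \<rho> and \<mu> = "\<sigma>\<^sup>2 / 2"])
    show "real (deg r) \<le> 9 / 20 * n" if "r \<in> low" for r using that by (simp add: low_def)
    show "200 * C * \<rho> \<le> 1"
    proof -
      have "C * \<rho> \<le> C * \<sigma>" using rho_sigma by (intro mult_left_mono) auto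
      then show ?thesis using sigma_C eta_sq eta1 eta0 by linarith
    qed
    show "\<rho> \<le> 1 / 1000" using rho_sigma sigma_le by linarith
    show "2 * (\<sigma>\<^sup>2 / 2) + \<rho> * \<eta> \<le> \<eta>\<^sup>2"
    proof -
      have "\<sigma>\<^sup>2 \<le> (\<eta> / 4)\<^sup>2" using sigma0 sigma_le(1) by (intro power_mono) auto
      then have "\<sigma>\<^sup>2 \<le> \<eta>\<^sup>2 / 16" by (simp add: power_divide)
      moreover have "\<rho> * \<eta> \<le> \<rho> * 1" using rho0 eta1 by (intro mult_left_mono) auto
      moreover have "0 \<le> \<eta>\<^sup>2" by simp
      ultimately show ?thesis unfolding rho by linarith
    qed
    show "2000 * C * (\<sigma> * n + 1) \<le> \<eta>\<^sup>2 * n"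
    proof -
      have "2000 * C * (\<sigma> * n + 1) = 2000 * (C * \<sigma>) * n + 2000 * C" by (simp add: algebra_simps)
      also have "\<dots> = \<eta>\<^sup>2 * n / 2 + 2000 * C" unfolding sigma_C by simp
      finally show ?thesis using n(3) by linarith
    qed
  qed (use C eta0 eta_C rho0 low defect sigma0 n(1) lower G5 in auto)
  then obtain z where z: "low = {z}" by (auto simp: card_1_singleton_iff)
  have sub: "H \<subseteq> (\<lambda>(x, y). {x, y, z}) ` (X \<times> Y)"
  proof
    fix h assume h: "h \<in> H"
    obtain r a b where r: "r \<in> low" "h = {r, a, b}" "a \<in> low \<or> b \<in> low \<or> a \<in> X \<and> b \<in> Y"
      using H_meets_R[OF h] by blast
    then have "r = z" "a \<in> X" "b \<in> Y" using H_distinct h unfolding z by blast+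
    moreover have "{r, a, b} = {a, b, r}" by auto
    ultimately show "h \<in> (\<lambda>(x, y). {x, y, z}) ` (X \<times> Y)" using r(2) by auto
  qed
  have fin: "finite (X \<times> Y)" using fins by simp
  have "card X + card Y = card V - 1" using card_parts by (simp add: z)
  moreover have "4 * (card X * card Y) \<le> (card X + card Y)\<^sup>2"
    by (rule four_mult_le_square)
  ultimately have le: "card X * card Y \<le> (card V - 1)\<^sup>2 div 4" by simp
  have img: "card ((\<lambda>(x, y). {x, y, z}) ` (X \<times> Y)) \<le> card X * card Y"
    using card_image_le[OF fin, of "\<lambda>(x, y). {x, y, z}"] by (simp only: card_cartesian_product)
  \<comment> \<open>The upper bound on \<open>card X * card Y\<close> meets the lower bound on
    \<open>card H\<close>, so the inclusion \<open>sub\<close> and all the inequalities are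
    equalities.\<close>
  have "H = (\<lambda>(x, y). {x, y, z}) ` (X \<times> Y)"
    by (rule card_seteq[OF _ sub]) (use fin le img cardH in auto)
  moreover have "card X * card Y = (card V - 1)\<^sup>2 div 4"
    using card_mono[OF finite_imageI[OF fin] sub] le img cardH by linarith
  moreover have "z \<notin> X" "z \<notin> Y" "X \<inter> Y = {}" "{z} \<union> X \<union> Y = V" using cover disj z by auto
  ultimately show ?thesis by (intro exI conjI) assumption+
qed

end

lemma sparse_triples_star:
  fixes C :: nat
  assumes C: "1 \<le> C"
  shows "\<exists>N. \<forall>(V :: 'a set) H. sparse_triples V H C \<and> N \<le> card V \<and> (card V - 1)\<^sup>2 div 4 \<le> card H \<longrightarrow>
    (\<exists>z X Y. z \<notin> X \<and> z \<notin> Y \<and> X \<inter> Y = {} \<and> {z} \<union> X \<union> Y = V \<and>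
      H = (\<lambda>(x, y). {x, y, z}) ` (X \<times> Y) \<and> card X * card Y = (card V - 1)\<^sup>2 div 4)"
proof -
  define \<eta> where "\<eta> = 1 / (200 * real C)"
  define \<sigma> where "\<sigma> = \<eta>\<^sup>2 / (4000 * real C)"
  define \<rho> where "\<rho> = \<sigma>\<^sup>2 / 8"
  define \<delta> where "\<delta> = \<rho> / 800"
  have pos: "0 < \<eta>" "0 < \<delta>" using C by (simp_all add: \<eta>_def \<sigma>_def \<rho>_def \<delta>_def)
  obtain N0 where N0: "\<And>(V :: 'a set) E. finite V \<and> N0 \<le> card V \<and> E \<subseteq> V \<times> V \<and> sym E \<and>
      (\<forall>u v. (u, v) \<in> E \<longrightarrow> card {w. (u, w) \<in> E \<and> (v, w) \<in> E} \<le> C) \<Longrightarrow>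
      card {(z, u, v). (z, u) \<in> E \<and> (z, v) \<in> E \<and> (u, v) \<in> E} \<le> \<delta> / 2 * (card V)\<^sup>2"
    using few_triangles[OF C, of "\<delta> / 2"] pos by auto
  \<comment> \<open>The sum of all thresholds exceeds each of them, as none is negative.\<close>
  define M where "M = real N0 + 100 + C / \<delta> + 4000 * C / \<eta>\<^sup>2 + 2 / \<delta>"
  show ?thesis
  proof (intro exI[of _ "nat \<lceil>M\<rceil>"] allI impI, elim conjE)
    fix V :: "'a set" and H
    assume S: "sparse_triples V H C" and N: "nat \<lceil>M\<rceil> \<le> card V"
      and cardH: "(card V - 1)\<^sup>2 div 4 \<le> card H"
    interpret sparse_triples V H C by (rule S)
    have "M \<le> n" using N by linarith
    moreover have "0 \<le> C / \<delta>" "0 \<le> 4000 * C / \<eta>\<^sup>2" "0 \<le> 2 / \<delta>" using pos by simp_all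
    ultimately have big: "N0 \<le> n" "100 \<le> n" "C / \<delta> \<le> n" "4000 * C / \<eta>\<^sup>2 \<le> n" "2 / \<delta> \<le> n"
      unfolding M_def by linarith+
    have "card {(z, u, v). (z, u) \<in> E2 \<and> (z, v) \<in> E2 \<and> (u, v) \<in> E2} \<le> \<delta> / 2 * (card V)\<^sup>2"
      by (rule N0) (use big finV E2_subset sym_E2 E2_common in auto)
    then have B: "card B \<le> \<delta> / 2 * n\<^sup>2" using card_B_le_triangles by simp
    show "\<exists>z X Y. z \<notin> X \<and> z \<notin> Y \<and> X \<inter> Y = {} \<and> {z} \<union> X \<union> Y = V \<and>
      H = (\<lambda>(x, y). {x, y, z}) ` (X \<times> Y) \<and> card X * card Y = (card V - 1)\<^sup>2 div 4"
    proof (rule star_structure[OF C \<eta>_def \<sigma>_def \<rho>_def \<delta>_def big(2) _ _ _ B cardH])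
      show "C \<le> \<delta> * n" "2 \<le> \<delta> * n" "4000 * C \<le> \<eta>\<^sup>2 * n"
        using big pos by (simp_all add: pos_divide_le_eq mult.commute)
    qed
  qed
qed

section \<open>Identification with \<open>star_bip\<close>\<close>

lemma balanced_product:
  fixes x y :: nat
  assumes "x \<le> y" and "x * y = (x + y)\<^sup>2 div 4"
  shows "x = (x + y) div 2"
proof -
  obtain d where d: "y = x + d" using assms(1) by (metis le_Suc_ex)
  have "(x + y)\<^sup>2 = d * d + 4 * (x * y)" by (simp add: d power2_eq_square algebra_simps)
  \<comment> \<open>Attaining the rounded maximum leaves a difference \<open>d\<close> with
    \<open>d * d < 4\<close>, so the sizes differ by at most 1.\<close>
  then have "d * d div 4 = 0" using assms(2) by simp
  then have "d < 2" using mult_mono[of 2 d 2 d] by (cases "d < 2") auto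
  then show ?thesis by (simp add: d)
qed

lemma isomorphic_star_bip:
  assumes V: "z \<notin> X" "z \<notin> Y" "X \<inter> Y = {}" "{z} \<union> X \<union> Y = {..<n}"
    and H: "H = (\<lambda>(x, y). {x, y, z}) ` (X \<times> Y)" and card: "card X * card Y = (n - 1)\<^sup>2 div 4"
  shows "\<exists>\<pi>. bij_betw \<pi> {..<n} {..<n} \<and> (\<lambda>h. \<pi> ` h) ` H = star_bip n"
proof -
  have fin: "finite X" "finite Y" using V(4) by (auto intro: finite_subset[of _ "{..<n}"])
  have n: "card X + card Y + 1 = n"
  proof -
    have "card ({z} \<union> X \<union> Y) = card X + card Y + 1"
      using V fin by (subst card_Un_disjoint) auto
    then show ?thesis using V(4) by simp
  qed
  \<comment> \<open>Stated for arbitrary sides because \<open>star_bip\<close> puts the smaller part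
    first; it is applied to \<open>X\<close> and \<open>Y\<close> in either order.\<close>
  have *: "\<exists>\<pi>. bij_betw \<pi> {..<n} {..<n} \<and> (\<lambda>h. \<pi> ` h) ` ((\<lambda>(x, y). {x, y, z}) ` (A \<times> D)) = star_bip n"
    if A: "z \<notin> A" "z \<notin> D" "A \<inter> D = {}" "{z} \<union> A \<union> D = {..<n}" "finite A" "finite D"
      "card A + card D + 1 = n" "card A * card D = (n - 1)\<^sup>2 div 4" "card A \<le> card D" for A D
  proof -
    let ?m = "(n - 1) div 2"
    have sum: "n - 1 = card A + card D" using A(7) by simp
    have cA: "card A = ?m"
      unfolding sum by (rule balanced_product[OF A(9)]) (use A(8) in \<open>simp only: sum\<close>)
    have cD: "card D = card {?m..<n - 1}" using cA sum by simp
    obtain f where f: "bij_betw f A {..<?m}"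
      using finite_same_card_bij[OF A(5), of "{..<?m}"] cA by auto
    obtain g where g: "bij_betw g D {?m..<n - 1}"
      using finite_same_card_bij[OF A(6), of "{?m..<n - 1}"] cD by auto
    \<comment> \<open>Within \<open>{..<n}\<close> the default value \<open>n - 1\<close> is taken
      only at \<open>z\<close>.\<close>
    define \<pi> where "\<pi> x = (if x \<in> A then f x else if x \<in> D then g x else n - 1)" for x
    have bA: "bij_betw \<pi> A {..<?m}"
      using f by (rule bij_betw_cong[THEN iffD1, rotated]) (simp add: \<pi>_def)
    have bD: "bij_betw \<pi> D {?m..<n - 1}"
      using g by (rule bij_betw_cong[THEN iffD1, rotated]) (use A(3) in \<open>auto simp: \<pi>_def\<close>)
    have \<pi>z: "\<pi> z = n - 1" using A by (simp add: \<pi>_def)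
    have bz: "bij_betw \<pi> {z} {n - 1}" using \<pi>z by (simp add: bij_betw_def)
    have "bij_betw \<pi> (A \<union> D) ({..<?m} \<union> {?m..<n - 1})"
      by (rule bij_betw_combine[OF bA bD]) auto
    then have "bij_betw \<pi> (A \<union> D \<union> {z}) ({..<?m} \<union> {?m..<n - 1} \<union> {n - 1})"
      by (rule bij_betw_combine[OF _ bz]) auto
    moreover have "A \<union> D \<union> {z} = {..<n}" using A(4) by auto
    moreover have "{..<?m} \<union> {?m..<n - 1} \<union> {n - 1} = {..<n}" using A(7) by auto
    ultimately have "bij_betw \<pi> {..<n} {..<n}" by simp
    moreover have "(\<lambda>h. \<pi> ` h) ` ((\<lambda>(x, y). {x, y, z}) ` (A \<times> D)) = star_bip n"
    proof -
      have "(\<lambda>h. \<pi> ` h) ` ((\<lambda>(x, y). {x, y, z}) ` (A \<times> D))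
          = (\<lambda>(a, b). {a, b, n - 1}) ` (map_prod \<pi> \<pi> ` (A \<times> D))"
        by (simp add: image_image case_prod_unfold \<pi>z)
      also have "map_prod \<pi> \<pi> ` (A \<times> D) = {..<?m} \<times> {?m..<n - 1}"
        by (rule map_prod_surj_on[OF bij_betw_imp_surj_on[OF bA] bij_betw_imp_surj_on[OF bD]])
      also have "(\<lambda>(a, b). {a, b, n - 1}) ` \<dots> = star_bip n" by (rule star_bip_image[symmetric])
      finally show ?thesis .
    qed
    ultimately show ?thesis by blast
  qed
  show ?thesis
  proof (cases "card X \<le> card Y")
    case True
    show ?thesis unfolding H by (rule *) (use V fin n card True in auto)
  next
    case False
    have "H = (\<lambda>(x, y). {x, y, z}) ` (Y \<times> X)"
      unfolding H by (auto simp: image_iff insert_commute)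
    then show ?thesis
    proof (elim ssubst, intro *)
      show "{z} \<union> Y \<union> X = {..<n}" "Y \<inter> X = {}" using V by auto
      show "card Y * card X = (n - 1)\<^sup>2 div 4" using card by (simp add: mult.commute)
    qed (use V fin n False in simp_all)
  qed
qed

theorem theorem1:
  fixes t :: nat
  assumes "t \<ge> 1"
  shows "\<exists>n0. \<forall>n\<ge>n0.
           ex3_trace n (book_V t) (book_E t) = (n - 1)^2 div 4 \<and>
           uniform3_on n (star_bip n) \<and> \<not> contains_trace (star_bip n) (book_V t) (book_E t) \<and>
           card (star_bip n) = (n - 1)^2 div 4 \<and>
           (\<forall>H. uniform3_on n H \<and> \<not> contains_trace H (book_V t) (book_E t) \<and>
                card H = (n - 1)^2 div 4 \<longrightarrow>
                (\<exists>\<pi>. bij_betw \<pi> {..<n} {..<n} \<and> (\<lambda>h. \<pi> ` h) ` H = star_bip n))"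
proof -
  obtain N where N: "\<forall>(V :: nat set) H. sparse_triples V H (5 * t) \<and> N \<le> card V \<and> (card V - 1)\<^sup>2 div 4 \<le> card H \<longrightarrow>
    (\<exists>z X Y. z \<notin> X \<and> z \<notin> Y \<and> X \<inter> Y = {} \<and> {z} \<union> X \<union> Y = V \<and>
      H = (\<lambda>(x, y). {x, y, z}) ` (X \<times> Y) \<and> card X * card Y = (card V - 1)\<^sup>2 div 4)"
    using sparse_triples_star[of "5 * t"] assms by auto
  show ?thesis
  proof (intro exI[of _ N] allI impI)
    fix n assume n: "N \<le> n"
    \<comment> \<open>Assuming only a lower bound on \<open>card H\<close> gives uniqueness and the
      upper bound at once: a larger \<open>H\<close> would also be isomorphic to
      \<open>star_bip n\<close>, hence no larger after all.\<close>
    have iso: "\<exists>\<pi>. bij_betw \<pi> {..<n} {..<n} \<and> (\<lambda>h. \<pi> ` h) ` H = star_bip n"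
      if H: "uniform3_on n H" "\<not> contains_trace H (book_V t) (book_E t)" "(n - 1)\<^sup>2 div 4 \<le> card H" for H
    proof -
      have "sparse_triples {..<n} H (5 * t)"
      proof
        fix u v w assume "{u, v, w} \<in> H"
        show "card (pages H u v) \<le> 5 * t"
        proof (rule ccontr)
          assume "\<not> ?thesis"
          then have "contains_trace H (book_V t) (book_E t)"
            using H(1) \<open>{u, v, w} \<in> H\<close> by (intro contains_book_trace) (auto simp: uniform3_on_def)
          then show False using H(2) by simp
        qed
      qed (use H(1) in \<open>auto simp: uniform3_on_def\<close>)
      moreover have "N \<le> card {..<n}" "(card {..<n} - 1)\<^sup>2 div 4 \<le> card H" using n H(3) by simp_all
      ultimately have "sparse_triples {..<n} H (5 * t) \<and> N \<le> card {..<n} \<and> (card {..<n} - 1)\<^sup>2 div 4 \<le> card H"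
        by (intro conjI)
      from N[rule_format, OF this] obtain z X Y where XY: "z \<notin> X" "z \<notin> Y" "X \<inter> Y = {}" "{z} \<union> X \<union> Y = {..<n}"
        "H = (\<lambda>(x, y). {x, y, z}) ` (X \<times> Y)" and c: "card X * card Y = (card {..<n} - 1)\<^sup>2 div 4"
        by (elim exE conjE)
      show ?thesis by (rule isomorphic_star_bip[OF XY]) (use c in simp)
    qed
    have card_le: "card H \<le> (n - 1)\<^sup>2 div 4"
      if H: "uniform3_on n H" "\<not> contains_trace H (book_V t) (book_E t)" for H
    proof (rule ccontr)
      assume gt: "\<not> ?thesis"
      then have "(n - 1)\<^sup>2 div 4 \<le> card H" by simp
      from iso[OF H this] obtain \<pi> where \<pi>: "bij_betw \<pi> {..<n} {..<n}" "(\<lambda>h. \<pi> ` h) ` H = star_bip n"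
        by (elim exE conjE)
      have "inj_on (\<lambda>h. \<pi> ` h) H"
      proof (rule inj_on_subset)
        show "inj_on (\<lambda>h. \<pi> ` h) (Pow {..<n})"
          using \<pi>(1) by (simp add: bij_betw_def inj_on_image_Pow)
      qed (use H(1) in \<open>auto simp: uniform3_on_def\<close>)
      then have "card H = card (star_bip n)" unfolding \<pi>(2)[symmetric] by (rule card_image[symmetric])
      then show False using gt card_star_bip by simp
    qed
    let ?F = "{H. uniform3_on n H \<and> \<not> contains_trace H (book_V t) (book_E t)}"
    have star: "star_bip n \<in> ?F" using uniform3_on_star_bip star_bip_trace_free[OF assms] by simp
    have "finite ?F"
      by (rule finite_subset[of _ "Pow (Pow {..<n})"]) (auto simp: uniform3_on_def)
    then have "Max (card ` ?F) = (n - 1)\<^sup>2 div 4"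
      using star card_star_bip[of n] card_le by (intro Max_eqI) (auto simp: image_iff intro!: bexI[of _ "star_bip n"])
    then show "ex3_trace n (book_V t) (book_E t) = (n - 1)^2 div 4 \<and>
           uniform3_on n (star_bip n) \<and> \<not> contains_trace (star_bip n) (book_V t) (book_E t) \<and>
           card (star_bip n) = (n - 1)^2 div 4 \<and>
           (\<forall>H. uniform3_on n H \<and> \<not> contains_trace H (book_V t) (book_E t) \<and>
                card H = (n - 1)^2 div 4 \<longrightarrow>
                (\<exists>\<pi>. bij_betw \<pi> {..<n} {..<n} \<and> (\<lambda>h. \<pi> ` h) ` H = star_bip n))"
      unfolding ex3_trace_def using star iso card_star_bip[of n] by (intro conjI allI impI) simp_all
  qed
qed

end
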